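(* Let $\sigma_{\mathsf{DP}}>0$ and let $\mathcal{A}$ be the private version of AMHT-LRS (described in the context) run for $\mathsf L$ iterations with clipping levels $\mathsf A_1,\mathsf A_2,\mathsf A_3,\mathsf A_w>0$ and noise multiplier $\sigma_{\mathsf{DP}}$. Then $\mathcal A$ satisfies $\sigma_{\mathsf{DP}}^{-2}$-zCDP in the billboard model, with respect to addition/removal of one user. Correspondingly, for $\varepsilon>0$ and $\delta\in(0,1)$, $\mathcal A$ satisfies $(\varepsilon,\delta)$-differential privacy in the billboard model whenever $$\sigma_{\mathsf{DP}}\ge 2\varepsilon^{-1}\sqrt{\log(1/\delta)+\varepsilon}.$$ Furthermore, if $\varepsilon\le\log(1/\delta)$, then $\sigma_{\mathsf{DP}}\ge\varepsilon^{-1}\sqrt{8\log(1/\delta)}$ suffices to ensure $(\varepsilon,\delta)$-differential privacy.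
   Context: **Differential privacy.** A data set is a collection of users, user $i$ holding $m$ samples $(\mathbf x^{(i)}_j,y^{(i)}_j)\in\mathbb R^d\times\mathbb R$, $j\in[m]$ (no distributional assumption). Data sets $D,D'$ are neighbours if they differ by the addition or removal of one user (all of that user's samples). A randomized algorithm $\mathcal A$ is $(\varepsilon,\delta)$-differentially private if $\Pr[\mathcal A(D)\in S]\le e^{\varepsilon}\Pr[\mathcal A(D')\in S]+\delta$ for all neighbours $D,D'$ and all measurable $S$. It is $\rho$-zCDP if $D_\alpha(\mathcal A(D)\|\mathcal A(D'))\le\alpha\rho$ for all neighbours $D,D'$ and all $\alpha>1$, where $D_\alpha$ is the Rényi divergence of order $\alpha$. **Billboard model.** The central algorithm publishes the shared matrices $\mathbf U^{+(\ell)}$ to all users; the user-specific quantities $\mathbf w^{(i,\ell)},\mathbf b^{(i,\ell)}$ are computed by user $i$ from the published matrices and that user's own data, and are kept by the user. An algorithm is $(\varepsilon,\delta)$-differentially private (respectively $\rho$-zCDP) in the billboard model if the randomized map sending a data set $D$ to the published sequence $(\mathbf U^{+(\ell)})_{\ell=1}^{\mathsf L}$ is $(\varepsilon,\delta)$-differentially private (respectively $\rho$-zCDP) with respect to data sets differing by the addition or removal of one user. **Clipping.** $\mathrm{clip}(x,\rho)=x\min\{1,\rho/|x|\}$ for a scalar $x$ and $\mathrm{clip}(\mathbf v,\rho)=\mathbf v\min\{1,\rho/\|\mathbf v\|_2\}$ for a vector. **Private AMHT-LRS.** $\mathbf U^{+(0)}\in\mathbb R^{d\times r}$ and all tuning parameters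 are fixed inputs. For $\ell=1,\dots,\mathsf L$: each user $i$ computes $\mathbf b^{(i,\ell)}\in\mathbb R^d$ (by a deterministic iterative hard-thresholding routine applied to the user's own data, $\mathbf U^{+(\ell-1)}\mathbf w^{(i,\ell-1)}$ and $\mathbf b^{(i,\ell-1)}$) and then $\mathbf w^{(i,\ell)}\in\mathbb R^r$ (by least squares from the user's own data, $\mathbf U^{+(\ell-1)}$ and $\mathbf b^{(i,\ell)}$). Put $\widehat{\mathbf x}^{(i)}_j=\mathrm{clip}(\mathbf x^{(i)}_j,\mathsf A_1)$, $\widehat y^{(i)}_j=\mathrm{clip}(y^{(i)}_j,\mathsf A_2)$, $\widehat q^{(i)}_j=\mathrm{clip}((\mathbf x^{(i)}_j)^T\mathbf b^{(i,\ell)},\mathsf A_3)$, $\widehat{\mathbf w}^{(i)}=\mathrm{clip}(\mathbf w^{(i,\ell)},\mathsf A_w)$. Then $$\mathbf A=\frac1{mt}\Big(\sum_{i\in[t]}\widehat{\mathbf w}^{(i)}(\widehat{\mathbf w}^{(i)})^T\otimes\sum_{j=1}^m\widehat{\mathbf x}^{(i)}_j(\widehat{\mathbf x}^{(i)}_j)^T+\mathbf N^{(1)}\Big),\qquad \mathbf V=\frac1{mt}\Big(\sum_{i\in[t]}\sum_{j\in[m]}\widehat{\mathbf x}^{(i)}_j(\widehat y^{(i)}_j-\widehat q^{(i)}_j)(\widehat{\mathbf w}^{(i)})^T+\mathbf N^{(2)}\Big),$$ where $t$ is the number of users, $\otimes$ is the Kronecker product, $\mathbf N^{(1)}\in\mathbb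 R^{rd\times rd}$ has i.i.d. entries $\mathcal N(0,m^2\mathsf A_1^4\mathsf A_w^4\mathsf L\sigma_{\mathsf{DP}}^2)$ and $\mathbf N^{(2)}\in\mathbb R^{d\times r}$ has i.i.d. entries $\mathcal N(0,m^2\mathsf A_1^2(\mathsf A_2+\mathsf A_3)^2\mathsf A_w^2\mathsf L\sigma_{\mathsf{DP}}^2)$, all noises independent of each other and across iterations. Finally $\mathbf U^{(\ell)}=\mathrm{vec}^{-1}_{d\times r}(\mathbf A^{-1}\mathrm{vec}(\mathbf V))$ ($\mathrm{vec}$ stacks columns), $\mathbf U^{+(\ell)}$ is the orthonormal factor of the QR factorization of $\mathbf U^{(\ell)}$, and $\mathbf U^{+(\ell)}$ is published. When the samples are split into batches, $m$ denotes the number of samples per user used in the update of $\mathbf U$ in an iteration. *)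

theory Defs
  imports "HOL-Probability.Probability"
begin

section \<open>Privacy notions\<close>

text \<open>\<open>RN_deriv Q P\<close> is the density of \<open>P\<close> with respect to \<open>Q\<close>. For probability measures the
  integral below is at least 1, so its real logarithm is meaningful when the integral is finite.\<close>

definition renyi_divergence :: "real \<Rightarrow> 'x measure \<Rightarrow> 'x measure \<Rightarrow> ereal" where
  "renyi_divergence \<alpha> P Q =
     (let I = (\<integral>\<^sup>+ x. ennreal (enn2real (RN_deriv Q P x) powr \<alpha>) \<partial>Q) in
      if absolutely_continuous Q P \<and> I < \<infinity>
      then ereal (ln (enn2real I) / (\<alpha> - 1))
      else \<infinity>)"

text \<open>A randomized algorithm is given by its output law \<open>M D\<close> on each data set \<open>D\<close>.\<close>

definition zCDP :: "('a \<Rightarrow> 'a \<Rightarrow> bool) \<Rightarrow> ('a \<Rightarrow> 'x measure) \<Rightarrow> real \<Rightarrow> bool" where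
  "zCDP nbr M \<rho> \<longleftrightarrow>
     (\<forall>D D'. nbr D D' \<longrightarrow> (\<forall>\<alpha>>1. renyi_divergence \<alpha> (M D) (M D') \<le> ereal (\<alpha> * \<rho>)))"

definition differentially_private ::
    "('a \<Rightarrow> 'a \<Rightarrow> bool) \<Rightarrow> ('a \<Rightarrow> 'x measure) \<Rightarrow> real \<Rightarrow> real \<Rightarrow> bool" where
  "differentially_private nbr M \<epsilon> \<delta> \<longleftrightarrow>
     (\<forall>D D'. nbr D D' \<longrightarrow>
        (\<forall>S \<in> sets (M D). measure (M D) S \<le> exp \<epsilon> * measure (M D') S + \<delta>))"

section \<open>Data sets\<close>

text \<open>Samples of one user are indexed by a finite type \<open>'s\<close>; users carry identifiers of
  type \<open>'i\<close>. A data set has at least one user, since the algorithm divides by their number.\<close>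

type_synonym ('s, 'd) samples = "'s \<Rightarrow> (real, 'd) vec \<times> real"
type_synonym ('i, 's, 'd) dataset = "'i \<Rightarrow> ('s, 'd) samples option"

definition is_dataset :: "('i, 's, 'd::finite) dataset \<Rightarrow> bool" where
  "is_dataset D \<longleftrightarrow> finite (dom D) \<and> dom D \<noteq> {}"

definition neighbours :: "('i, 's, 'd::finite) dataset \<Rightarrow> ('i, 's, 'd) dataset \<Rightarrow> bool" where
  "neighbours D D' \<longleftrightarrow> is_dataset D \<and> is_dataset D' \<and>
     (\<exists>i X. (i \<notin> dom D \<and> D' = D(i \<mapsto> X)) \<or> (i \<notin> dom D' \<and> D = D'(i \<mapsto> X)))"

section \<open>Clipping and matrix operations\<close>

text \<open>On \<open>real\<close> the norm is the absolute value, so this covers scalars and vectors. Since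
  \<open>c / 0 = 0\<close>, the zero vector is mapped to itself.\<close>

definition clip :: "'v::real_normed_vector \<Rightarrow> real \<Rightarrow> 'v" where
  "clip v c = min 1 (c / norm v) *\<^sub>R v"

definition outer :: "real^'n \<Rightarrow> real^'k \<Rightarrow> real^'k^'n" where
  "outer x y = (\<chi> i j. x $ i * y $ j)"

definition kronecker :: "real^'b^'a \<Rightarrow> real^'k^'n \<Rightarrow> real^('b \<times> 'k)^('a \<times> 'n)" where
  "kronecker A B = (\<chi> p q. A $ fst p $ fst q * B $ snd p $ snd q)"

text \<open>Column stacking: the entry in row \<open>i\<close> and column \<open>k\<close> gets index \<open>(k, i)\<close>, in accordance
  with the index convention of \<open>kronecker\<close>, so that
  \<open>kronecker (outer w w) (outer x x) *v stack_columns U = stack_columns (outer x x ** U ** outer w w)\<close>.\<close>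

definition stack_columns :: "real^'r^'d \<Rightarrow> real^('r \<times> 'd)" where
  "stack_columns V = (\<chi> p. V $ snd p $ fst p)"

definition unstack_columns :: "real^('r \<times> 'd) \<Rightarrow> real^'r^'d" where
  "unstack_columns v = (\<chi> i k. v $ (k, i))"

definition is_QR_factor ::
    "((real, 'r::{finite,linorder}) vec, 'd::finite) vec \<Rightarrow> ((real, 'r) vec, 'd) vec \<Rightarrow> bool" where
  "is_QR_factor U Q \<longleftrightarrow> transpose Q ** Q = mat 1 \<and>
     (\<exists>R :: ((real, 'r) vec, 'r) vec. (\<forall>i j. j < i \<longrightarrow> R $ i $ j = 0) \<and> U = Q ** R)"

section \<open>The private algorithm\<close>

text \<open>
  \<open>batch l\<close> are the samples used in iteration \<open>l\<close> for the update of the shared matrix, and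
  \<open>ls_batch l\<close> those used for the least squares problem; without sample splitting both are
  \<open>UNIV\<close>. The field \<open>batch_size\<close> is \<open>m\<close>. The routine \<open>sparse_step l X v b\<close> is the deterministic
  hard-thresholding routine of iteration \<open>l\<close> on the user's samples \<open>X\<close> (it may select its own
  batch), the shared part \<open>v\<close> and the previous sparse part \<open>b\<close>. It may be any measurable function
  of these inputs, whatever its step sizes, thresholds and stopping rule. The field \<open>ls_step\<close> is a least squares
  solver and \<open>qr\<close> returns the orthonormal factor of a QR factorization. As neither
  minimizers nor QR factors are unique, any measurable choice is allowed.\<close>

record ('i, 's, 'd::finite, 'r::finite) amht_input =
  iterations :: nat
  clip_x :: real
  clip_y :: real
  clip_q :: real
  clip_w :: real
  noise_mult :: real
  batch_size :: nat
  batch :: "nat \<Rightarrow> 's set"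
  ls_batch :: "nat \<Rightarrow> 's set"
  init_U :: "real^'r^'d"
  init_w :: "'i \<Rightarrow> ('s, 'd) samples \<Rightarrow> real^'r"
  init_b :: "'i \<Rightarrow> ('s, 'd) samples \<Rightarrow> real^'d"
  sparse_step :: "nat \<Rightarrow> ('s, 'd) samples \<Rightarrow> real^'d \<Rightarrow> real^'d \<Rightarrow> real^'d"
  ls_step :: "nat \<Rightarrow> ('s, 'd) samples \<Rightarrow> real^'r^'d \<Rightarrow> real^'d \<Rightarrow> real^'r"
  qr :: "real^'r^'d \<Rightarrow> real^'r^'d"

definition ls_loss ::
    "'s set \<Rightarrow> ('s, 'd) samples \<Rightarrow> real^'r^'d \<Rightarrow> real^'d \<Rightarrow> real^'r \<Rightarrow> real" where
  "ls_loss B X U b w = (\<Sum>j\<in>B. (snd (X j) - fst (X j) \<bullet> (U *v w + b))\<^sup>2)"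

definition amht_wf ::
    "('i, 's::finite, 'd::finite, 'r::{finite,linorder}) amht_input \<Rightarrow> bool" where
  "amht_wf c \<longleftrightarrow>
     0 < batch_size c \<and> (\<forall>l\<in>{1..iterations c}. card (batch c l) = batch_size c) \<and>
     (\<forall>l X. (\<lambda>(v, b). sparse_step c l X v b) \<in> borel_measurable borel) \<and>
     (\<forall>l X. (\<lambda>(U, b). ls_step c l X U b) \<in> borel_measurable borel) \<and>
     (\<forall>l X U b. is_arg_min (ls_loss (ls_batch c l) X U b) (\<lambda>_. True) (ls_step c l X U b)) \<and>
     qr c \<in> borel_measurable borel \<and>
     (\<forall>U. is_QR_factor U (qr c U))"

text \<open>The update of the shared matrix from the current user vectors \<open>w\<close>, \<open>b\<close> and the noise
  matrices \<open>N1\<close>, \<open>N2\<close>. The matrix \<open>A\<close> is invertible for almost every \<open>N1\<close>.\<close>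

definition amht_A ::
    "('i, 's, 'd, 'r) amht_input \<Rightarrow> ('i, 's, 'd::finite) dataset \<Rightarrow> nat \<Rightarrow>
     ('i \<Rightarrow> real^'r) \<Rightarrow> real^('r::finite \<times> 'd)^('r \<times> 'd) \<Rightarrow> real^('r \<times> 'd)^('r \<times> 'd)" where
  "amht_A c D l w N1 =
     (1 / (real (batch_size c) * real (card (dom D)))) *\<^sub>R
       ((\<Sum>i\<in>dom D.
           let X = the (D i); w' = clip (w i) (clip_w c) in
           kronecker (outer w' w')
             (\<Sum>j\<in>batch c l. outer (clip (fst (X j)) (clip_x c)) (clip (fst (X j)) (clip_x c))))
        + N1)"

definition amht_V ::
    "('i, 's, 'd, 'r) amht_input \<Rightarrow> ('i, 's, 'd::finite) dataset \<Rightarrow> nat \<Rightarrow>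
     ('i \<Rightarrow> real^'r::finite) \<Rightarrow> ('i \<Rightarrow> real^'d) \<Rightarrow> real^'r^'d \<Rightarrow> real^'r^'d" where
  "amht_V c D l w b N2 =
     (1 / (real (batch_size c) * real (card (dom D)))) *\<^sub>R
       ((\<Sum>i\<in>dom D. \<Sum>j\<in>batch c l.
           let X = the (D i) in
           (clip (snd (X j)) (clip_y c) - clip (fst (X j) \<bullet> b i) (clip_q c)) *\<^sub>R
             outer (clip (fst (X j)) (clip_x c)) (clip (w i) (clip_w c)))
        + N2)"

type_synonym ('d, 'r) noise =
  "nat \<Rightarrow> ((real, 'r \<times> 'd) vec, 'r \<times> 'd) vec \<times> ((real, 'r) vec, 'd) vec"

primrec amht_state ::
    "('i, 's, 'd::finite, 'r::finite) amht_input \<Rightarrow> ('i, 's, 'd) dataset \<Rightarrow> ('d, 'r) noise \<Rightarrow> nat \<Rightarrow>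
     (real^'r^'d) \<times> ('i \<Rightarrow> real^'r) \<times> ('i \<Rightarrow> real^'d)" where
  "amht_state c D N 0 =
     (init_U c, (\<lambda>i. init_w c i (the (D i))), (\<lambda>i. init_b c i (the (D i))))"
| "amht_state c D N (Suc l) =
     (let (U, w, b) = amht_state c D N l;
          b' = (\<lambda>i. sparse_step c (Suc l) (the (D i)) (U *v w i) (b i));
          w' = (\<lambda>i. ls_step c (Suc l) (the (D i)) U (b' i));
          A = amht_A c D (Suc l) w' (fst (N (Suc l)));
          V = amht_V c D (Suc l) w' b' (snd (N (Suc l)))
      in (qr c (unstack_columns (matrix_inv A *v stack_columns V)), w', b'))"

definition published ::
    "('i, 's, 'd::finite, 'r::finite) amht_input \<Rightarrow> ('i, 's, 'd) dataset \<Rightarrow> ('d, 'r) noise \<Rightarrow>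
     nat \<Rightarrow> real^'r^'d" where
  "published c D N = (\<lambda>l\<in>{1..iterations c}. fst (amht_state c D N l))"

text \<open>Random matrix with i.i.d. \<open>\<N>(0, v)\<close> entries, \<open>v\<close> being the variance.\<close>

definition gaussian_matrix :: "real \<Rightarrow> (real^'k::finite^'n::finite) measure" where
  "gaussian_matrix v =
     distr (\<Pi>\<^sub>M p\<in>(UNIV :: ('n \<times> 'k) set). density lborel (normal_density 0 (sqrt v)))
       borel (\<lambda>f. \<chi> i j. f (i, j))"

definition noise_law ::
    "('i, 's, 'd::finite, 'r::finite) amht_input \<Rightarrow> ('d, 'r) noise measure" where
  "noise_law c =
     (let m = real (batch_size c); L = real (iterations c); \<sigma> = noise_mult c in
      \<Pi>\<^sub>M l\<in>{1..iterations c}.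
        gaussian_matrix (m^2 * clip_x c ^ 4 * clip_w c ^ 4 * L * \<sigma>^2) \<Otimes>\<^sub>M
        gaussian_matrix (m^2 * clip_x c ^ 2 * (clip_y c + clip_q c)^2 * clip_w c ^ 2 * L * \<sigma>^2))"

text \<open>The law of the published sequence of shared matrices. Privacy in the billboard model is
  privacy of this map; the vectors \<open>w\<close> and \<open>b\<close> stay with the users.\<close>

definition amht_billboard ::
    "('i, 's, 'd::finite, 'r::finite) amht_input \<Rightarrow> ('i, 's, 'd) dataset \<Rightarrow>
     (nat \<Rightarrow> real^'r^'d) measure" where
  "amht_billboard c D =
     distr (noise_law c) (\<Pi>\<^sub>M l\<in>{1..iterations c}. borel) (published c D)"

end

theory Submission
  imports Defs
begin

text \<open>In each iteration the update depends on the data only through two noisy sums, one term per user,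
  and adding a user moves them by at most \<open>m A\<^sub>1\<^sup>2 A\<^sub>w\<^sup>2\<close> and \<open>m A\<^sub>1 (A\<^sub>2 + A\<^sub>3) A\<^sub>w\<close> in Frobenius norm.
  Two Gaussians with entry variance \<open>v\<close> and shift \<open>\<Delta>\<close> have Renyi divergence \<open>\<alpha> * norm \<Delta>\<^sup>2 / (2 * v)\<close>, so
  each sum costs \<open>1 / (2 * L * \<sigma>\<^sup>2)\<close>. The users' private vectors are functions of the matrices published
  so far, hence the iterations compose adaptively to \<open>1 / \<sigma>\<^sup>2\<close>. Optimizing the order \<open>\<alpha>\<close> converts this
  into approximate differential privacy.\<close>

section \<open>Renyi domination\<close>

text \<open>The divergence of an adaptive process is usually computed with conditional densities,
  which would have to be chosen jointly measurable in the history. Testing against functions asks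
  only that the inner integral be measurable in the history. The constant has a simple origin:
  \<open>exp ((\<alpha> - 1) * \<rho>)\<close> is the norm of the density dP/dQ in L^\<alpha>(Q)
  when the divergence equals \<open>\<alpha> * \<rho>\<close>, and
  \<open>\<alpha> / (\<alpha> - 1)\<close> is the exponent conjugate to \<alpha>. Test functions are
  bounded, so every integral is finite.

  A second obstacle is the factor 1/(mt): it scales the noise as well as the data, and t differs
  between neighbours, so the matrices A and V of two neighbours are not shifts of one another. The
  update uses only the quotient of V by A, from which the factor disappears, provided that A is
  invertible. Hence the need for almost sure invertibility under Gaussian noise, and the comparison
  of laws instead of pointwise values.\<close>

text \<open>The Hoelder-dual form of \<open>D\<^sub>\<alpha>(P \<parallel> Q) \<le> \<alpha> * \<rho>\<close>. It involves no densities, so it passes to image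
  measures and composes along kernels by plain iterated integration.\<close>

definition renyi_dominated :: "real \<Rightarrow> real \<Rightarrow> 'x measure \<Rightarrow> 'x measure \<Rightarrow> bool" where
  "renyi_dominated \<alpha> \<rho> P Q \<longleftrightarrow> prob_space P \<and> prob_space Q \<and> sets P = sets Q \<and>
     (\<forall>f C. f \<in> borel_measurable Q \<longrightarrow> (\<forall>x. 0 \<le> f x \<and> f x \<le> C) \<longrightarrow>
        (\<integral>x. f x \<partial>P) \<le>
          exp ((\<alpha> - 1) * \<rho>) * (\<integral>x. f x powr (\<alpha> / (\<alpha> - 1)) \<partial>Q) powr ((\<alpha> - 1) / \<alpha>))"

lemma renyi_dominatedD:
  assumes "renyi_dominated \<alpha> \<rho> P Q"
  shows "prob_space P" "prob_space Q" "sets P = sets Q"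
    and "\<And>f C. f \<in> borel_measurable Q \<Longrightarrow> (\<And>x. 0 \<le> f x) \<Longrightarrow> (\<And>x. f x \<le> C) \<Longrightarrow>
        (\<integral>x. f x \<partial>P) \<le>
          exp ((\<alpha> - 1) * \<rho>) * (\<integral>x. f x powr (\<alpha> / (\<alpha> - 1)) \<partial>Q) powr ((\<alpha> - 1) / \<alpha>)"
  using assms unfolding renyi_dominated_def by blast+

lemma renyi_dominatedI:
  assumes "prob_space P" "prob_space Q" "sets P = sets Q"
    and "\<And>f C. f \<in> borel_measurable Q \<Longrightarrow> (\<And>x. 0 \<le> f x) \<Longrightarrow> (\<And>x. f x \<le> C) \<Longrightarrow>
        (\<integral>x. f x \<partial>P) \<le>
          exp ((\<alpha> - 1) * \<rho>) * (\<integral>x. f x powr (\<alpha> / (\<alpha> - 1)) \<partial>Q) powr ((\<alpha> - 1) / \<alpha>)"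
  shows "renyi_dominated \<alpha> \<rho> P Q"
  using assms unfolding renyi_dominated_def by blast

lemma integrable_bounded:
  fixes f :: "'x \<Rightarrow> real"
  assumes "prob_space M" "f \<in> borel_measurable M" "\<And>x. 0 \<le> f x" "\<And>x. f x \<le> C"
  shows "integrable M f"
proof -
  interpret prob_space M by fact
  show ?thesis
    by (rule integrable_const_bound[where B = C]) (use assms in auto)
qed

lemma integral_bounded:
  fixes f :: "'x \<Rightarrow> real"
  assumes "prob_space M" "\<And>x. 0 \<le> f x" "\<And>x. f x \<le> C"
  shows "0 \<le> (\<integral>x. f x \<partial>M)" "(\<integral>x. f x \<partial>M) \<le> C"
proof -
  interpret prob_space M by fact
  have C: "0 \<le> C"
    using assms(2,3) order_trans by blast
  show "0 \<le> (\<integral>x. f x \<partial>M)"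
    using assms(2) by simp
  show "(\<integral>x. f x \<partial>M) \<le> C"
  proof (cases "integrable M f")
    case True
    then have "(\<integral>x. f x \<partial>M) \<le> (\<integral>x. C \<partial>M)"
      by (intro integral_mono) (use assms in auto)
    then show ?thesis by (simp add: prob_space)
  next
    \<comment> \<open>The Bochner integral of a nonintegrable function is 0, which lies in the same
      range because \<open>C\<close> is nonnegative.\<close>
    case False
    then show ?thesis using C by (simp add: not_integrable_integral_eq)
  qed
qed

lemma renyi_dominated_mono:
  assumes "renyi_dominated \<alpha> \<rho> P Q" "\<rho> \<le> \<rho>'" "\<alpha> > 1"
  shows "renyi_dominated \<alpha> \<rho>' P Q"
proof (rule renyi_dominatedI)
  fix f :: "'a \<Rightarrow> real" and C
  assume "f \<in> borel_measurable Q" "\<And>x. 0 \<le> f x" "\<And>x. f x \<le> C"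
  from renyi_dominatedD(4)[OF assms(1) this]
  have "(\<integral>x. f x \<partial>P) \<le>
          exp ((\<alpha> - 1) * \<rho>) * (\<integral>x. f x powr (\<alpha> / (\<alpha> - 1)) \<partial>Q) powr ((\<alpha> - 1) / \<alpha>)" .
  also have "\<dots> \<le> exp ((\<alpha> - 1) * \<rho>') * (\<integral>x. f x powr (\<alpha> / (\<alpha> - 1)) \<partial>Q) powr ((\<alpha> - 1) / \<alpha>)"
    using assms by (intro mult_right_mono) auto
  finally show "(\<integral>x. f x \<partial>P) \<le>
      exp ((\<alpha> - 1) * \<rho>') * (\<integral>x. f x powr (\<alpha> / (\<alpha> - 1)) \<partial>Q) powr ((\<alpha> - 1) / \<alpha>)" .
qed (use renyi_dominatedD[OF assms(1)] in auto)

text \<open>Data processing: a test function on the target pulls back along \<open>T\<close> to a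
  test function on the source with the same integrals.\<close>

lemma renyi_dominated_distr:
  assumes dom: "renyi_dominated \<alpha> \<rho> P Q" and T: "T \<in> measurable Q N"
  shows "renyi_dominated \<alpha> \<rho> (distr P N T) (distr Q N T)"
proof -
  note D = renyi_dominatedD[OF dom]
  have TP: "T \<in> measurable P N"
    using T D(3) by (simp cong: measurable_cong_sets)
  show ?thesis
  proof (rule renyi_dominatedI)
    fix f :: "'b \<Rightarrow> real" and C
    assume f: "f \<in> borel_measurable (distr Q N T)" and b: "\<And>x. 0 \<le> f x" "\<And>x. f x \<le> C"
    have f': "f \<in> borel_measurable N" using f by simp
    have "(\<integral>x. f (T x) \<partial>P) \<le>
        exp ((\<alpha> - 1) * \<rho>) * (\<integral>x. f (T x) powr (\<alpha> / (\<alpha> - 1)) \<partial>Q) powr ((\<alpha> - 1) / \<alpha>)"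
      using f' T b by (intro D(4)) auto
    then show "(\<integral>x. f x \<partial>(distr P N T)) \<le> exp ((\<alpha> - 1) * \<rho>) *
        (\<integral>x. f x powr (\<alpha> / (\<alpha> - 1)) \<partial>(distr Q N T)) powr ((\<alpha> - 1) / \<alpha>)"
      using f' T TP by (simp add: integral_distr)
  qed (use D T TP in \<open>auto intro: prob_space.prob_space_distr\<close>)
qed

lemma holder_inequality:
  fixes f r :: "'x \<Rightarrow> real"
  assumes M: "prob_space M" and p: "p > 1" "q > 1" "1 / p + 1 / q = 1"
    and f: "f \<in> borel_measurable M" "\<And>x. 0 \<le> f x" "\<And>x. f x \<le> C"
    and r: "r \<in> borel_measurable M" "\<And>x. 0 \<le> r x" "integrable M (\<lambda>x. r x powr q)"
  shows "(\<integral>x. f x * r x \<partial>M) \<le>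
    (\<integral>x. f x powr p \<partial>M) powr (1 / p) * (\<integral>x. r x powr q \<partial>M) powr (1 / q)"
proof -
  interpret prob_space M by fact
  define F where "F = (\<integral>x. f x powr p \<partial>M)"
  define R where "R = (\<integral>x. r x powr q \<partial>M)"
  have fp: "integrable M (\<lambda>x. f x powr p)"
  proof (rule integrable_bounded[OF M])
    show "f x powr p \<le> C powr p" for x
      using f p by (intro powr_mono2) auto
  qed (use f in auto)
  have FR: "0 \<le> F" "0 \<le> R"
    by (auto simp: F_def R_def)
  \<comment> \<open>Young's inequality is applied after dividing both factors by their norms, so
    vanishing norms are treated separately; the integrand is then 0 almost everywhere.\<close>
  show ?thesis
  proof (cases "F = 0 \<or> R = 0")
    case True
    then have "AE x in M. f x * r x = 0"
    proof
      assume "F = 0"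
      then have "AE x in M. f x powr p = 0"
        using fp by (simp add: F_def integral_nonneg_eq_0_iff_AE)
      then show ?thesis by eventually_elim auto
    next
      assume "R = 0"
      then have "AE x in M. r x powr q = 0"
        using r by (simp add: R_def integral_nonneg_eq_0_iff_AE)
      then show ?thesis by eventually_elim auto
    qed
    then have "(\<integral>x. f x * r x \<partial>M) = (\<integral>x. 0 \<partial>M)"
      using f r by (intro integral_cong_AE) auto
    then show ?thesis by simp
  next
    case False
    with FR have pos: "0 < F" "0 < R" by auto
    define c where "c = F powr (1 / p) * R powr (1 / q)"
    have c: "c > 0" using pos by (simp add: c_def)
    have young: "f x * r x \<le> c * (f x powr p / (F * p) + r x powr q / (R * q))" for x
    proof -
      have "(f x / F powr (1 / p)) * (r x / R powr (1 / q)) \<le>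
          (f x / F powr (1 / p)) powr p / p + (r x / R powr (1 / q)) powr q / q"
        using p f(2) r(2) pos by (intro Youngs_inequality) auto
      also have "(f x / F powr (1 / p)) powr p = f x powr p / F"
        using f(2) pos p by (simp add: powr_divide powr_powr)
      also have "(r x / R powr (1 / q)) powr q = r x powr q / R"
        using r(2) pos p by (simp add: powr_divide powr_powr)
      finally have "f x * r x / c \<le> f x powr p / (F * p) + r x powr q / (R * q)"
        by (simp add: c_def)
      then show ?thesis using c by (simp add: field_simps)
    qed
    have int: "integrable M (\<lambda>x. c * (f x powr p / (F * p) + r x powr q / (R * q)))"
      using fp r(3) by auto
    have "(\<integral>x. f x * r x \<partial>M) \<le> (\<integral>x. c * (f x powr p / (F * p) + r x powr q / (R * q)) \<partial>M)"
    proof (rule integral_mono)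
      show "integrable M (\<lambda>x. f x * r x)"
      proof (rule Bochner_Integration.integrable_bound[OF int])
        show "AE x in M. norm (f x * r x) \<le>
            norm (c * (f x powr p / (F * p) + r x powr q / (R * q)))"
          using f(2) r(2) order_trans[OF young abs_ge_self] by simp
      qed (use f r in auto)
    qed (use int young in auto)
    also have "\<dots> = c * (F / (F * p) + R / (R * q))"
      using fp r(3) by (simp add: F_def R_def)
    also have "\<dots> = c"
      using pos p by simp
    finally show ?thesis by (simp add: c_def F_def R_def)
  qed
qed

text \<open>Hoelder with exponents \<open>\<alpha> / (\<alpha> - 1)\<close> on the test function and
  \<alpha> on the density. The bound \<open>exp (\<alpha> * (\<alpha> - 1) * \<rho>)\<close> is the
  moment that corresponds to divergence \<open>\<alpha> * \<rho>\<close>, and its root of order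
  \<alpha> is the constant of the dual form.\<close>

lemma renyi_dominated_density:
  assumes M: "prob_space M" and \<alpha>: "\<alpha> > 1"
    and r: "r \<in> borel_measurable M" "\<And>x. 0 \<le> r x" "integrable M (\<lambda>x. r x powr \<alpha>)"
    and P: "prob_space (density M (\<lambda>x. ennreal (r x)))"
    and le: "(\<integral>x. r x powr \<alpha> \<partial>M) \<le> exp (\<alpha> * (\<alpha> - 1) * \<rho>)"
  shows "renyi_dominated \<alpha> \<rho> (density M (\<lambda>x. ennreal (r x))) M"
proof (rule renyi_dominatedI)
  fix f :: "'a \<Rightarrow> real" and C
  assume f: "f \<in> borel_measurable M" "\<And>x. 0 \<le> f x" "\<And>x. f x \<le> C"
  have "(\<integral>x. f x \<partial>(density M (\<lambda>x. ennreal (r x)))) = (\<integral>x. f x * r x \<partial>M)"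
    using f r by (simp add: integral_density mult.commute)
  also have "\<dots> \<le> (\<integral>x. f x powr (\<alpha> / (\<alpha> - 1)) \<partial>M) powr (1 / (\<alpha> / (\<alpha> - 1))) *
      (\<integral>x. r x powr \<alpha> \<partial>M) powr (1 / \<alpha>)"
    by (rule holder_inequality[OF M _ _ _ f r]) (use \<alpha> in \<open>auto simp: field_simps\<close>)
  also have "\<dots> \<le> (\<integral>x. f x powr (\<alpha> / (\<alpha> - 1)) \<partial>M) powr (1 / (\<alpha> / (\<alpha> - 1))) *
      exp (\<alpha> * (\<alpha> - 1) * \<rho>) powr (1 / \<alpha>)"
    using \<alpha> le by (intro mult_left_mono powr_mono2) auto
  also have "exp (\<alpha> * (\<alpha> - 1) * \<rho>) powr (1 / \<alpha>) = exp ((\<alpha> - 1) * \<rho>)"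
    using \<alpha> by (simp add: powr_def)
  finally show "(\<integral>x. f x \<partial>(density M (\<lambda>x. ennreal (r x)))) \<le>
      exp ((\<alpha> - 1) * \<rho>) * (\<integral>x. f x powr (\<alpha> / (\<alpha> - 1)) \<partial>M) powr ((\<alpha> - 1) / \<alpha>)"
    by (simp add: mult.commute)
qed (use M P in auto)

lemma renyi_dominated_refl:
  assumes M: "prob_space M" and \<alpha>: "\<alpha> > 1"
  shows "renyi_dominated \<alpha> 0 M M"
proof -
  interpret prob_space M by fact
  show ?thesis
    using renyi_dominated_density[OF M \<alpha>, of "\<lambda>_. 1" 0] M
    by (simp add: prob_space density_1)
qed

section \<open>Composition along kernels and products\<close>

lemma powr_bounded:
  fixes f :: "'x \<Rightarrow> real"
  assumes "\<And>x. 0 \<le> f x" "\<And>x. f x \<le> C" "p \<ge> 0"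
  shows "f x powr p \<le> C powr p"
  using assms by (intro powr_mono2) auto

text \<open>Domination of the kernels bounds the inner integral by a constant times
  \<open>G x\<close>, where \<open>G\<close> is the inner integral over \<open>Q2 x\<close> raised
  to \<open>(\<alpha> - 1) / \<alpha>\<close>. Since \<open>G\<close> is again a bounded test
  function, domination of the first stage applies to it; the two exponents are reciprocal, so the
  outer power undoes the inner one and the costs add.\<close>

lemma renyi_dominated_compose:
  fixes f :: "'x \<Rightarrow> 'y \<Rightarrow> real"
  assumes \<alpha>: "\<alpha> > 1"
    and dom1: "renyi_dominated \<alpha> \<rho>1 P1 Q1"
    and dom2: "\<And>x. x \<in> space Q1 \<Longrightarrow> renyi_dominated \<alpha> \<rho>2 (P2 x) (Q2 x)"
    and fm: "\<And>x. x \<in> space Q1 \<Longrightarrow> f x \<in> borel_measurable (Q2 x)"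
    and bd: "\<And>x y. 0 \<le> f x y" "\<And>x y. f x y \<le> C"
    and Pm: "(\<lambda>x. \<integral>y. f x y \<partial>P2 x) \<in> borel_measurable Q1"
    and Qm: "(\<lambda>x. \<integral>y. f x y powr (\<alpha> / (\<alpha> - 1)) \<partial>Q2 x) \<in> borel_measurable Q1"
  shows "(\<integral>x. \<integral>y. f x y \<partial>P2 x \<partial>P1) \<le> exp ((\<alpha> - 1) * (\<rho>1 + \<rho>2)) *
      (\<integral>x. \<integral>y. f x y powr (\<alpha> / (\<alpha> - 1)) \<partial>Q2 x \<partial>Q1) powr ((\<alpha> - 1) / \<alpha>)"
proof -
  let ?b = "\<alpha> / (\<alpha> - 1)" and ?c = "(\<alpha> - 1) / \<alpha>"
  have b: "?b > 0" "?c > 0" using \<alpha> by auto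
  note D1 = renyi_dominatedD[OF dom1]
  have space1: "space P1 = space Q1" using D1(3) by (rule sets_eq_imp_space_eq)
  have meas1: "g \<in> borel_measurable P1 \<longleftrightarrow> g \<in> borel_measurable Q1" for g :: "'x \<Rightarrow> real"
    by (rule measurable_cong_sets[OF D1(3) refl, THEN arg_cong])
  \<comment> \<open>Test functions must be bounded at every point, while the kernels are controlled
    only on the space of \<open>Q1\<close>; the value 0 elsewhere repairs this.\<close>
  define F where "F x = (if x \<in> space Q1 then (\<integral>y. f x y powr ?b \<partial>Q2 x) else 0)" for x
  define G where "G x = F x powr ?c" for x
  have "C powr ?b \<ge> 0" by simp
  then have Fb: "0 \<le> F x" "F x \<le> C powr ?b" for x
    using integral_bounded[OF renyi_dominatedD(2)[OF dom2], of x "\<lambda>y. f x y powr ?b"]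
      powr_bounded[of "f x" C ?b] bd b unfolding F_def by auto
  have Gb: "0 \<le> G x" "G x \<le> (C powr ?b) powr ?c" for x
    unfolding G_def using powr_bounded[of F "C powr ?b" ?c] Fb b by auto
  have "F \<in> borel_measurable Q1"
    using Qm by (rule measurable_cong[THEN iffD1, rotated]) (simp add: F_def)
  then have Gm: "G \<in> borel_measurable Q1"
    unfolding G_def by measurable
  have "(\<integral>x. \<integral>y. f x y \<partial>P2 x \<partial>P1) \<le> (\<integral>x. exp ((\<alpha> - 1) * \<rho>2) * G x \<partial>P1)"
  proof (rule integral_mono)
    define H where "H x = (if x \<in> space Q1 then (\<integral>y. f x y \<partial>P2 x) else 0)" for x
    have "0 \<le> C" using bd order_trans by blast
    then have Hb: "0 \<le> H x" "H x \<le> C" for x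
      using integral_bounded[OF renyi_dominatedD(1)[OF dom2], of x "f x"] bd unfolding H_def by auto
    have Hm: "H \<in> borel_measurable P1"
      unfolding meas1 using Pm by (rule measurable_cong[THEN iffD1, rotated]) (simp add: H_def)
    have "integrable P1 H" by (rule integrable_bounded[OF D1(1) Hm Hb])
    then show "integrable P1 (\<lambda>x. \<integral>y. f x y \<partial>P2 x)"
      by (rule Bochner_Integration.integrable_cong[THEN iffD1, rotated -1])
        (auto simp: H_def space1)
    show "integrable P1 (\<lambda>x. exp ((\<alpha> - 1) * \<rho>2) * G x)"
      using Gm by (intro integrable_mult_right integrable_bounded[OF D1(1) _ Gb]) (simp add: meas1)
    fix x assume "x \<in> space P1"
    then have x: "x \<in> space Q1" by (simp add: space1)
    show "(\<integral>y. f x y \<partial>P2 x) \<le> exp ((\<alpha> - 1) * \<rho>2) * G x"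
      using renyi_dominatedD(4)[OF dom2[OF x] fm[OF x] bd] x by (simp add: G_def F_def)
  qed
  also have "\<dots> = exp ((\<alpha> - 1) * \<rho>2) * (\<integral>x. G x \<partial>P1)"
    by simp
  also have "\<dots> \<le> exp ((\<alpha> - 1) * \<rho>2) *
      (exp ((\<alpha> - 1) * \<rho>1) * (\<integral>x. G x powr ?b \<partial>Q1) powr ?c)"
    by (intro mult_left_mono D1(4)[OF Gm Gb]) auto
  also have "(\<integral>x. G x powr ?b \<partial>Q1) = (\<integral>x. \<integral>y. f x y powr ?b \<partial>Q2 x \<partial>Q1)"
    using \<alpha> Fb by (intro Bochner_Integration.integral_cong) (auto simp: G_def powr_powr, simp add: F_def)
  also have "exp ((\<alpha> - 1) * \<rho>2) * (exp ((\<alpha> - 1) * \<rho>1) * z) = exp ((\<alpha> - 1) * (\<rho>1 + \<rho>2)) * z" for z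
    by (simp add: distrib_left exp_add)
  finally show ?thesis .
qed

text \<open>Fubini splits off one coordinate at a time, and a kernel that ignores the earlier
  coordinates is a special case of composition.\<close>

lemma renyi_dominated_PiM:
  assumes \<alpha>: "\<alpha> > 1" and fin: "finite I"
    and dom: "\<And>i. renyi_dominated \<alpha> (\<rho> i) (P i) (Q i)"
  shows "renyi_dominated \<alpha> (\<Sum>i\<in>I. \<rho> i) (PiM I P) (PiM I Q)"
  using fin
proof (induction I rule: finite_induct)
  case empty
  have "prob_space (PiM {} P)" by (intro prob_space_PiM) auto
  moreover have "PiM {} P = PiM {} Q" by (simp add: PiM_empty)
  ultimately show ?case using renyi_dominated_refl \<alpha> by (metis sum.empty)
next
  case (insert i I)
  interpret P: product_sigma_finite P using renyi_dominatedD(1)[OF dom]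
    by (intro product_sigma_finite.intro prob_space_imp_sigma_finite)
  have probP: "prob_space (PiM J P)" for J
    by (intro prob_space_PiM renyi_dominatedD(1)[OF dom])
  interpret Q: product_sigma_finite Q using renyi_dominatedD(2)[OF dom]
    by (intro product_sigma_finite.intro prob_space_imp_sigma_finite)
  have probQ: "prob_space (PiM J Q)" for J
    by (intro prob_space_PiM renyi_dominatedD(2)[OF dom])
  have sets: "sets (P i) = sets (Q i)" for i using renyi_dominatedD(3)[OF dom] .
  have setsPi: "sets (PiM J P) = sets (PiM J Q)" for J
    by (rule sets_PiM_cong) (auto simp: sets)
  note [measurable_cong] = sets setsPi
  show ?case
  proof (rule renyi_dominatedI)
    fix f :: "_ \<Rightarrow> real" and C
    assume f[measurable]: "f \<in> borel_measurable (PiM (insert i I) Q)"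
      and bd: "\<And>x. 0 \<le> f x" "\<And>x. f x \<le> C"
    have f'[measurable]: "f \<in> borel_measurable (PiM (insert i I) P)"
      using f by (simp cong: measurable_cong_sets add: setsPi)
    have "(\<integral>x. f x \<partial>(PiM (insert i I) P)) = (\<integral>x. (\<integral>y. f (x(i := y)) \<partial>P i) \<partial>(PiM I P))"
      by (rule P.product_integral_insert)
        (use insert in \<open>auto intro!: integrable_bounded[OF probP f' bd]\<close>)
    also have "\<dots> \<le> exp ((\<alpha> - 1) * ((\<Sum>i\<in>I. \<rho> i) + \<rho> i)) *
        (\<integral>x. (\<integral>y. f (x(i := y)) powr (\<alpha> / (\<alpha> - 1)) \<partial>Q i) \<partial>(PiM I Q)) powr ((\<alpha> - 1) / \<alpha>)"
      by (rule renyi_dominated_compose[OF \<alpha> insert.IH dom _ bd]) measurable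
    also have "(\<integral>x. (\<integral>y. f (x(i := y)) powr (\<alpha> / (\<alpha> - 1)) \<partial>Q i) \<partial>(PiM I Q)) =
        (\<integral>x. f x powr (\<alpha> / (\<alpha> - 1)) \<partial>(PiM (insert i I) Q))"
      by (rule Q.product_integral_insert[symmetric])
        (use insert \<alpha> powr_bounded[OF bd, of "\<alpha> / (\<alpha> - 1)"] in
          \<open>auto intro!: integrable_bounded[OF probQ]\<close>)
    finally show "(\<integral>x. f x \<partial>(PiM (insert i I) P)) \<le> exp ((\<alpha> - 1) * (\<Sum>i\<in>insert i I. \<rho> i)) *
        (\<integral>x. f x powr (\<alpha> / (\<alpha> - 1)) \<partial>(PiM (insert i I) Q)) powr ((\<alpha> - 1) / \<alpha>)"
      using insert by (simp add: add.commute)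
  qed (auto simp: probP probQ setsPi)
qed

lemma renyi_dominated_pair:
  assumes \<alpha>: "\<alpha> > 1"
    and dom1: "renyi_dominated \<alpha> \<rho>1 P1 Q1" and dom2: "renyi_dominated \<alpha> \<rho>2 P2 Q2"
  shows "renyi_dominated \<alpha> (\<rho>1 + \<rho>2) (P1 \<Otimes>\<^sub>M P2) (Q1 \<Otimes>\<^sub>M Q2)"
proof -
  interpret P1: prob_space P1 using renyi_dominatedD(1)[OF dom1] .
  interpret P2: prob_space P2 using renyi_dominatedD(1)[OF dom2] .
  interpret Q1: prob_space Q1 using renyi_dominatedD(2)[OF dom1] .
  interpret Q2: prob_space Q2 using renyi_dominatedD(2)[OF dom2] .
  interpret P: pair_prob_space P1 P2 ..
  interpret Q: pair_prob_space Q1 Q2 ..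
  note [measurable_cong] = renyi_dominatedD(3)[OF dom1] renyi_dominatedD(3)[OF dom2]
  have sets: "sets (P1 \<Otimes>\<^sub>M P2) = sets (Q1 \<Otimes>\<^sub>M Q2)"
    by (rule sets_pair_measure_cong[OF renyi_dominatedD(3)[OF dom1] renyi_dominatedD(3)[OF dom2]])
  show ?thesis
  proof (rule renyi_dominatedI)
    fix f :: "_ \<Rightarrow> real" and C
    assume f[measurable]: "f \<in> borel_measurable (Q1 \<Otimes>\<^sub>M Q2)"
      and bd: "\<And>x. 0 \<le> f x" "\<And>x. f x \<le> C"
    have f'[measurable]: "f \<in> borel_measurable (P1 \<Otimes>\<^sub>M P2)"
      using f by (simp cong: measurable_cong_sets add: sets)
    have "(\<integral>x. f x \<partial>(P1 \<Otimes>\<^sub>M P2)) = (\<integral>x. \<integral>y. f (x, y) \<partial>P2 \<partial>P1)"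
      by (rule P.integral_fst'[symmetric])
        (auto intro!: integrable_bounded[OF P.prob_space_axioms f' bd])
    also have "\<dots> \<le> exp ((\<alpha> - 1) * (\<rho>1 + \<rho>2)) *
        (\<integral>x. \<integral>y. f (x, y) powr (\<alpha> / (\<alpha> - 1)) \<partial>Q2 \<partial>Q1) powr ((\<alpha> - 1) / \<alpha>)"
      by (rule renyi_dominated_compose[OF \<alpha> dom1 dom2 _ bd]) measurable
    also have "(\<integral>x. \<integral>y. f (x, y) powr (\<alpha> / (\<alpha> - 1)) \<partial>Q2 \<partial>Q1) =
        (\<integral>x. f x powr (\<alpha> / (\<alpha> - 1)) \<partial>(Q1 \<Otimes>\<^sub>M Q2))"
      by (rule Q.integral_fst')
        (use \<alpha> powr_bounded[OF bd, of "\<alpha> / (\<alpha> - 1)"] in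
          \<open>auto intro!: integrable_bounded[OF Q.prob_space_axioms]\<close>)
    finally show "(\<integral>x. f x \<partial>(P1 \<Otimes>\<^sub>M P2)) \<le> exp ((\<alpha> - 1) * (\<rho>1 + \<rho>2)) *
        (\<integral>x. f x powr (\<alpha> / (\<alpha> - 1)) \<partial>(Q1 \<Otimes>\<^sub>M Q2)) powr ((\<alpha> - 1) / \<alpha>)" .
  qed (auto simp: P.prob_space_axioms Q.prob_space_axioms sets)
qed

section \<open>Gaussian matrices\<close>

lemma normal_density_shift_ratio:
  assumes s: "s > 0"
  shows "normal_density a s x = exp ((2 * a * x - a\<^sup>2) / (2 * s\<^sup>2)) * normal_density 0 s x"
proof -
  have "- (x - a)\<^sup>2 / (2 * s\<^sup>2) = (2 * a * x - a\<^sup>2) / (2 * s\<^sup>2) + - (x - 0)\<^sup>2 / (2 * s\<^sup>2)"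
    using s by (simp add: field_simps power2_eq_square)
  then have "exp (- (x - a)\<^sup>2 / (2 * s\<^sup>2)) =
      exp ((2 * a * x - a\<^sup>2) / (2 * s\<^sup>2)) * exp (- (x - 0)\<^sup>2 / (2 * s\<^sup>2))"
    by (simp only: exp_add)
  then show ?thesis
    by (simp add: normal_density_def)
qed

text \<open>Completing the square: a power of the likelihood ratio moves the mean from 0 to
  \<open>\<alpha> * a\<close> and leaves a constant factor. As the remaining density integrates to
  1, this factor is the whole moment.\<close>

lemma normal_density_shift_moment:
  assumes s: "s > 0"
  shows "exp ((2 * a * x - a\<^sup>2) / (2 * s\<^sup>2)) powr \<alpha> * normal_density 0 s x =
    exp (\<alpha> * (\<alpha> - 1) * (a\<^sup>2 / (2 * s\<^sup>2))) * normal_density (\<alpha> * a) s x"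
proof -
  have "\<alpha> * ((2 * a * x - a\<^sup>2) / (2 * s\<^sup>2)) =
      \<alpha> * (\<alpha> - 1) * (a\<^sup>2 / (2 * s\<^sup>2)) + (2 * (\<alpha> * a) * x - (\<alpha> * a)\<^sup>2) / (2 * s\<^sup>2)"
    using s by (simp add: field_simps power2_eq_square)
  then show ?thesis
    by (simp add: normal_density_shift_ratio[OF s, of "\<alpha> * a"] exp_add powr_def)
qed

lemma distr_normal_shift:
  "distr (density lborel (normal_density 0 s)) borel ((+) a) = density lborel (normal_density a s)"
proof (rule measure_eqI)
  fix A :: "real set" assume "A \<in> sets (distr (density lborel (normal_density 0 s)) borel ((+) a))"
  then have A[measurable]: "A \<in> sets borel" by simp
  have "emeasure (distr (density lborel (normal_density 0 s)) borel ((+) a)) A =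
      (\<integral>\<^sup>+x. normal_density 0 s x * indicator A (a + x) \<partial>lborel)"
  proof -
    have "(+) a -` A \<in> sets borel"
      by (rule measurable_sets_borel[OF _ A]) measurable
    then show ?thesis
      by (subst emeasure_distr)
        (auto simp: emeasure_density ennreal_mult' ennreal_indicator indicator_def intro!: nn_integral_cong)
  qed
  also have "\<dots> = (\<integral>\<^sup>+x. normal_density a s (a + x) * indicator A (a + x) \<partial>lborel)"
    by (simp add: normal_density_def)
  also have "\<dots> = (\<integral>\<^sup>+x. normal_density a s x * indicator A x \<partial>distr lborel borel ((+) a))"
    by (subst nn_integral_distr) auto
  also have "\<dots> = emeasure (density lborel (normal_density a s)) A"
    by (simp add: lborel_distr_plus emeasure_density ennreal_mult' ennreal_indicator)
  finally show "emeasure (distr (density lborel (normal_density 0 s)) borel ((+) a)) A = \<dots>" .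
qed simp

lemma renyi_dominated_normal_shift:
  assumes \<alpha>: "\<alpha> > 1" and s: "s > 0"
  shows "renyi_dominated \<alpha> (a\<^sup>2 / (2 * s\<^sup>2))
    (distr (density lborel (normal_density 0 s)) borel ((+) a)) (density lborel (normal_density 0 s))"
proof -
  let ?N = "density lborel (normal_density 0 s)"
  let ?r = "\<lambda>x. exp ((2 * a * x - a\<^sup>2) / (2 * s\<^sup>2))"
  interpret N: prob_space ?N using s by (rule prob_space_normal_density)
  have eq: "density ?N (\<lambda>x. ennreal (?r x)) = density lborel (normal_density a s)"
    by (subst density_density_eq)
      (auto simp: normal_density_shift_ratio[OF s, of a] ennreal_mult' mult.commute intro!: density_cong)
  have mom: "normal_density 0 s x * ?r x powr \<alpha> =
      exp (\<alpha> * (\<alpha> - 1) * (a\<^sup>2 / (2 * s\<^sup>2))) * normal_density (\<alpha> * a) s x" for x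
    using normal_density_shift_moment[OF s, of a x \<alpha>] by (simp add: mult.commute)
  have "renyi_dominated \<alpha> (a\<^sup>2 / (2 * s\<^sup>2)) (density ?N (\<lambda>x. ennreal (?r x))) ?N"
  proof (rule renyi_dominated_density[OF N.prob_space_axioms \<alpha>])
    show "integrable ?N (\<lambda>x. ?r x powr \<alpha>)"
      using s by (subst integrable_density) (auto simp: mom)
    show "(\<integral>x. ?r x powr \<alpha> \<partial>?N) \<le> exp (\<alpha> * (\<alpha> - 1) * (a\<^sup>2 / (2 * s\<^sup>2)))"
      using s by (subst integral_density) (auto simp: mom)
    show "prob_space (density ?N (\<lambda>x. ennreal (?r x)))"
      unfolding eq using s by (rule prob_space_normal_density)
  qed auto
  then show ?thesis by (simp add: eq distr_normal_shift)
qed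

lemma borel_measurable_vec_lambda[measurable (raw)]:
  fixes f :: "'x \<Rightarrow> 'n::finite \<Rightarrow> 'b::euclidean_space"
  assumes "\<And>i. (\<lambda>x. f x i) \<in> borel_measurable M"
  shows "(\<lambda>x. \<chi> i. f x i) \<in> borel_measurable M"
proof (subst borel_measurable_euclidean_space, intro ballI)
  fix b :: "'b^'n" assume "b \<in> Basis"
  then obtain i u where b: "b = axis i u" by (auto simp: Basis_vec_def)
  show "(\<lambda>x. (\<chi> i. f x i) \<bullet> b) \<in> borel_measurable M"
    using assms[of i] by (simp add: b inner_axis)
qed

lemma borel_measurable_vec_nth[measurable (raw)]:
  fixes f :: "'x \<Rightarrow> 'b::euclidean_space^'n::finite"
  assumes "f \<in> borel_measurable M"
  shows "(\<lambda>x. f x $ i) \<in> borel_measurable M"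
  using assms by (rule measurable_compose) (intro borel_measurable_continuous_onI continuous_intros)

lemma borel_measurable_matrix_of_entries[measurable]:
  "(\<lambda>f. \<chi> i j. f (i, j)) \<in> borel_measurable
    (PiM (UNIV :: ('n::finite \<times> 'k::finite) set) (\<lambda>p. density lborel (normal_density 0 s)))"
  by measurable

lemma prob_space_gaussian_matrix:
  assumes "v > 0"
  shows "prob_space (gaussian_matrix v :: (real^'k::finite^'n::finite) measure)"
  unfolding gaussian_matrix_def
  by (intro prob_space.prob_space_distr prob_space_PiM prob_space_normal_density) (use assms in auto)

lemma sets_gaussian_matrix[simp, measurable_cong]: "sets (gaussian_matrix v) = sets borel"
  by (simp add: gaussian_matrix_def)

lemma space_gaussian_matrix[simp]: "space (gaussian_matrix v) = UNIV"
  by (simp add: gaussian_matrix_def)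

lemma norm_matrix_power2: "(norm (\<Delta> :: real^'k::finite^'n::finite))\<^sup>2 = (\<Sum>p\<in>UNIV. (\<Delta> $ fst p $ snd p)\<^sup>2)"
proof -
  have "(norm \<Delta>)\<^sup>2 = (\<Sum>i\<in>UNIV. \<Sum>j\<in>UNIV. (\<Delta> $ i $ j)\<^sup>2)"
    by (simp add: norm_vec_def L2_set_def sum_nonneg)
  then show ?thesis
    by (simp add: sum.cartesian_product UNIV_Times_UNIV[symmetric] case_prod_beta del: UNIV_Times_UNIV)
qed

text \<open>Independent coordinates stay independent when each is mapped on its own. This turns the
  translate of a Gaussian matrix into a product of translated scalar normals.\<close>

lemma distr_PiM_coordinatewise:
  assumes I: "finite I" and M: "\<And>i. prob_space (M i)"
    and g[measurable]: "\<And>i. g i \<in> measurable (M i) (N i)"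
  shows "distr (PiM I M) (PiM I N) (\<lambda>f. \<lambda>i\<in>I. g i (f i)) = PiM I (\<lambda>i. distr (M i) (N i) (g i))"
proof -
  interpret M: product_sigma_finite M
    using M by (intro product_sigma_finite.intro prob_space_imp_sigma_finite)
  interpret D: product_sigma_finite "\<lambda>i. distr (M i) (N i) (g i)"
    using M g by (intro product_sigma_finite.intro prob_space_imp_sigma_finite prob_space.prob_space_distr)
  show ?thesis
  proof (rule D.PiM_eqI[OF I])
    show "sets (distr (PiM I M) (PiM I N) (\<lambda>f. \<lambda>i\<in>I. g i (f i))) =
        sets (PiM I (\<lambda>i. distr (M i) (N i) (g i)))"
      by (simp cong: sets_PiM_cong)
  next
    fix A assume "\<And>i. i \<in> I \<Longrightarrow> A i \<in> sets (distr (M i) (N i) (g i))"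
    then have A[measurable]: "\<And>i. i \<in> I \<Longrightarrow> A i \<in> sets (N i)" by simp
    have "emeasure (distr (PiM I M) (PiM I N) (\<lambda>f. \<lambda>i\<in>I. g i (f i))) (Pi\<^sub>E I A) =
        emeasure (PiM I M) ((\<lambda>f. \<lambda>i\<in>I. g i (f i)) -` (Pi\<^sub>E I A) \<inter> space (PiM I M))"
      using I A by (intro emeasure_distr sets_PiM_I_finite) auto
    also have "(\<lambda>f. \<lambda>i\<in>I. g i (f i)) -` (Pi\<^sub>E I A) \<inter> space (PiM I M) =
        (\<Pi>\<^sub>E i\<in>I. g i -` A i \<inter> space (M i))"
      by (auto simp: space_PiM PiE_iff)
    also have "emeasure (PiM I M) \<dots> = (\<Prod>i\<in>I. emeasure (M i) (g i -` A i \<inter> space (M i)))"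
      using I A g by (intro M.emeasure_PiM) (auto intro: measurable_sets)
    also have "\<dots> = (\<Prod>i\<in>I. emeasure (distr (M i) (N i) (g i)) (A i))"
      using A g by (intro prod.cong) (auto simp: emeasure_distr)
    finally show "emeasure (distr (PiM I M) (PiM I N) (\<lambda>f. \<lambda>i\<in>I. g i (f i))) (Pi\<^sub>E I A) = \<dots>" .
  qed
qed

text \<open>The entries are independent, so their costs add, and the squared entries of the shift
  sum to its squared Frobenius norm, which is the norm of the nested vector type.\<close>

lemma renyi_dominated_gaussian_matrix_shift:
  fixes \<Delta> :: "real^'k::finite^'n::finite"
  assumes \<alpha>: "\<alpha> > 1" and v: "v > 0"
  shows "renyi_dominated \<alpha> ((norm \<Delta>)\<^sup>2 / (2 * v))
    (distr (gaussian_matrix v) borel ((+) \<Delta>)) (gaussian_matrix v)"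
proof -
  let ?N = "density lborel (normal_density 0 (sqrt v))"
  let ?I = "UNIV :: ('n \<times> 'k) set"
  let ?a = "\<lambda>p. \<Delta> $ fst p $ snd p"
  have s: "sqrt v > 0" using v by simp
  interpret N: prob_space ?N using s by (rule prob_space_normal_density)
  have "renyi_dominated \<alpha> (\<Sum>p\<in>?I. (?a p)\<^sup>2 / (2 * (sqrt v)\<^sup>2))
      (PiM ?I (\<lambda>p. distr ?N borel ((+) (?a p)))) (PiM ?I (\<lambda>p. ?N))"
    by (intro renyi_dominated_PiM renyi_dominated_normal_shift \<alpha> s) simp
  from renyi_dominated_distr[OF this borel_measurable_matrix_of_entries]
  have "renyi_dominated \<alpha> (\<Sum>p\<in>?I. (?a p)\<^sup>2 / (2 * (sqrt v)\<^sup>2))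
      (distr (PiM ?I (\<lambda>p. distr ?N borel ((+) (?a p)))) borel (\<lambda>f. \<chi> i j. f (i, j)))
      (gaussian_matrix v)"
    by (simp add: gaussian_matrix_def)
  also have "PiM ?I (\<lambda>p. distr ?N borel ((+) (?a p))) =
      distr (PiM ?I (\<lambda>p. ?N)) (PiM ?I (\<lambda>p. borel)) (\<lambda>f. \<lambda>p\<in>?I. ?a p + f p)"
    by (subst distr_PiM_coordinatewise) (auto simp: N.prob_space_axioms)
  also have "distr \<dots> borel (\<lambda>f. \<chi> i j. f (i, j)) = distr (gaussian_matrix v) borel ((+) \<Delta>)"
    by (simp add: gaussian_matrix_def distr_distr comp_def vec_eq_iff plus_vec_def)
  also have "(\<Sum>p\<in>?I. (?a p)\<^sup>2 / (2 * (sqrt v)\<^sup>2)) = (norm \<Delta>)\<^sup>2 / (2 * v)"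
    using v by (simp add: norm_matrix_power2 sum_divide_distrib)
  finally show ?thesis .
qed

section \<open>Events under domination, and almost sure invertibility of Gaussian matrices\<close>

lemma renyi_dominated_measure:
  assumes dom: "renyi_dominated \<alpha> \<rho> P Q" and S: "S \<in> sets P"
  shows "measure P S \<le> exp ((\<alpha> - 1) * \<rho>) * measure Q S powr ((\<alpha> - 1) / \<alpha>)"
proof -
  note D = renyi_dominatedD[OF dom]
  interpret P: prob_space P by (rule D)
  interpret Q: prob_space Q by (rule D)
  have S': "S \<in> sets Q" using S D(3) by simp
  have "indicat_real S x powr p = indicat_real S x" for x p
    by (simp add: indicator_def)
  then show ?thesis
    using D(4)[of "indicat_real S" 1] S S' by simp
qed

text \<open>The power on the right sends 0 to 0, so absolute continuity is contained in domination
  at a single order.\<close>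

lemma renyi_dominated_null:
  assumes dom: "renyi_dominated \<alpha> \<rho> P Q" and S: "S \<in> null_sets Q"
  shows "S \<in> null_sets P"
proof -
  note D = renyi_dominatedD[OF dom]
  interpret P: prob_space P by (rule D)
  have SP: "S \<in> sets P" using S D(3) by auto
  have "measure P S \<le> 0"
    using renyi_dominated_measure[OF dom SP] S by (simp add: measure_eq_0_null_sets)
  then have "measure P S = 0" by (simp add: antisym)
  then show ?thesis using SP by (simp add: P.emeasure_eq_measure null_setsI)
qed

lemma borel_measurable_det[measurable (raw)]:
  fixes f :: "'x \<Rightarrow> real^'n::finite^'n"
  assumes [measurable]: "f \<in> borel_measurable M"
  shows "(\<lambda>x. det (f x)) \<in> borel_measurable M"
  unfolding det_def by measurable

lemma AE_gaussian_matrix_shift: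
  fixes \<Delta> :: "real^'k::finite^'n::finite"
  assumes v: "v > 0" and P[measurable]: "Measurable.pred borel P" and AE: "AE N in gaussian_matrix v. P N"
  shows "AE N in gaussian_matrix v. P (\<Delta> + N)"
proof -
  have "{N. \<not> P N} \<in> null_sets (gaussian_matrix v)"
    using AE by (subst (asm) AE_iff_null) auto
  then have "{N. \<not> P N} \<in> null_sets (distr (gaussian_matrix v) borel ((+) \<Delta>))"
    \<comment> \<open>Any order above 1 would serve; 2 is an arbitrary choice.\<close>
    by (rule renyi_dominated_null[OF renyi_dominated_gaussian_matrix_shift[of 2], rotated 2]) (use v in auto)
  then have "AE N in distr (gaussian_matrix v) borel ((+) \<Delta>). P N"
    by (rule AE_I') auto
  then show ?thesis by (subst (asm) AE_distr_iff) auto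
qed

text \<open>The determinant of \<open>M + s *\<^sub>R mat 1\<close> is a polynomial in
  \<open>s\<close>, written below as \<open>p\<close> through the Leibniz expansion. It is not the
  zero polynomial, because a shift beyond the operator norm of \<open>M\<close> leaves no
  kernel.\<close>

lemma finite_singular_shifts:
  fixes M :: "real^'n::finite^'n"
  shows "finite {s. det (M + s *\<^sub>R mat 1) = 0}"
proof -
  define p where "p = (\<Sum>\<pi> | \<pi> permutes (UNIV :: 'n set). [:of_int (sign \<pi>):] *
    (\<Prod>i\<in>UNIV. [: M $ i $ \<pi> i, if i = \<pi> i then 1 else 0 :]))"
  have p: "poly p s = det (M + s *\<^sub>R mat 1)" for s
    unfolding p_def det_def
    by (auto simp: poly_sum poly_prod mat_def intro!: sum.cong prod.cong)
  define s where "s = onorm ((*v) M) + 1"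
  have "det (M + s *\<^sub>R mat 1) \<noteq> 0"
  proof -
    have "x = 0" if x: "(M + s *\<^sub>R mat 1) *v x = 0" for x
    proof (rule ccontr)
      assume "x \<noteq> 0"
      have "M *v x + s *\<^sub>R x = 0"
        using x by (simp add: matrix_vector_mult_add_rdistrib scaleR_matrix_vector_assoc[symmetric])
      then have "norm (M *v x) = norm (s *\<^sub>R x)"
        by (metis add_eq_0_iff norm_minus_cancel)
      moreover have "norm (M *v x) \<le> onorm ((*v) M) * norm x"
        by (rule onorm) simp
      moreover have "0 \<le> onorm ((*v) M)"
        by (rule onorm_pos_le) simp
      ultimately have "(onorm ((*v) M) + 1) * norm x \<le> onorm ((*v) M) * norm x"
        by (simp add: s_def)
      then show False using \<open>x \<noteq> 0\<close> by (simp add: algebra_simps)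
    qed
    then show ?thesis
      by (metis invertible_det_nz invertible_left_inverse matrix_left_invertible_ker)
  qed
  then have "p \<noteq> 0" using p[of s] by auto
  from poly_roots_finite[OF this] show ?thesis by (simp add: p)
qed

text \<open>Along the direction of the identity matrix every line meets the singular matrices in a finite
  set, so by Fubini almost every translate of the singular matrices is a null set. Gaussian null
  sets are translation invariant.\<close>

lemma AE_gaussian_matrix_nonsingular:
  fixes S :: "real^'n::finite^'n"
  assumes v: "v > 0"
  shows "AE N in gaussian_matrix v. det (S + N) \<noteq> 0"
proof -
  let ?G = "gaussian_matrix v :: (real^'n^'n) measure"
  interpret G: prob_space ?G using v by (rule prob_space_gaussian_matrix)
  interpret pair_sigma_finite ?G "lborel :: real measure" ..
  have "AE N in ?G. AE s in lborel. det (S + (N + s *\<^sub>R mat 1)) \<noteq> 0"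
  proof (rule AE_I2)
    fix N
    have "{s. det ((S + N) + s *\<^sub>R mat 1) = 0} \<in> null_sets lborel"
      by (intro finite_imp_null_set_lborel finite_singular_shifts)
    then show "AE s in lborel. det (S + (N + s *\<^sub>R mat 1)) \<noteq> 0"
      by (rule AE_I') (auto simp: add.assoc)
  qed
  then have "AE s in lborel. AE N in ?G. det (S + (N + s *\<^sub>R mat 1)) \<noteq> 0"
  proof (subst (asm) AE_commute)
    have "{x \<in> space (borel \<Otimes>\<^sub>M borel). det (S + (fst x + snd x *\<^sub>R mat 1)) \<noteq> 0}
        \<in> sets (borel \<Otimes>\<^sub>M borel)"
      by measurable
    then show "{x \<in> space (?G \<Otimes>\<^sub>M lborel). det (S + (fst x + snd x *\<^sub>R mat 1)) \<noteq> 0}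
        \<in> sets (?G \<Otimes>\<^sub>M lborel)"
      by (simp add: space_pair_measure cong: sets_pair_measure_cong)
  qed
  \<comment> \<open>The line has nonzero Lebesgue measure, so a property of almost every
    \<open>s\<close> holds for at least one; translating the noise by the opposite multiple of the
    identity then removes this \<open>s\<close>.\<close>
  then have "\<exists>s. AE N in ?G. det (S + (N + s *\<^sub>R mat 1)) \<noteq> 0"
    by (rule contrapos_pp) (simp add: AE_iff_null null_sets_def)
  then obtain s where s: "AE N in ?G. det (S + (N + s *\<^sub>R mat 1)) \<noteq> 0" ..
  have "AE N in ?G. det (S + ((- s *\<^sub>R mat 1 + N) + s *\<^sub>R mat 1)) \<noteq> 0"
    by (rule AE_gaussian_matrix_shift[OF v _ s]) measurable
  then show ?thesis by simp
qed

section \<open>Conversion to Renyi divergence and approximate privacy\<close>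

text \<open>Dividing by the power of \<open>J\<close> on the right leaves the root of order \<alpha>
  of \<open>J\<close> on the left. The division requires a finite moment, which the truncation in
  the next proof provides.\<close>

lemma le_exp_of_self_bound:
  assumes \<alpha>: "\<alpha> > (1::real)" and J: "0 \<le> J" and le: "J \<le> exp k * J powr ((\<alpha> - 1) / \<alpha>)"
  shows "J \<le> exp (\<alpha> * k)"
proof (cases "J = 0")
  case False
  then have J: "J > 0" using J by simp
  then have "ln J \<le> ln (exp k * J powr ((\<alpha> - 1) / \<alpha>))" using le by simp
  also have "\<dots> = k + (\<alpha> - 1) / \<alpha> * ln J" using J by (simp add: ln_mult ln_powr)
  finally have "ln J \<le> \<alpha> * k" using \<alpha> by (simp add: field_simps)
  then show ?thesis using J exp_le_cancel_iff[of "ln J" "\<alpha> * k"] by simp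
qed simp

lemma renyi_divergence_le:
  assumes \<alpha>: "\<alpha> > 1" and \<rho>: "\<rho> \<ge> 0" and dom: "renyi_dominated \<alpha> \<rho> P Q"
  shows "renyi_divergence \<alpha> P Q \<le> ereal (\<alpha> * \<rho>)"
proof -
  note D = renyi_dominatedD[OF dom]
  interpret P: prob_space P by (rule D)
  interpret Q: prob_space Q by (rule D)
  have ac: "absolutely_continuous Q P"
    using renyi_dominated_null[OF dom] by (auto simp: absolutely_continuous_def)
  define p where "p x = enn2real (RN_deriv Q P x)" for x
  have pm[measurable]: "p \<in> borel_measurable Q" unfolding p_def by measurable
  have p0: "0 \<le> p x" for x by (simp add: p_def)
  \<comment> \<open>The derivative takes extended values, but it is finite almost everywhere, so its
    real version \<open>p\<close> is also a density.\<close>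
  have "AE x in Q. RN_deriv Q P x = ennreal (p x)"
    using Q.RN_deriv_finite[OF P.sigma_finite_measure_axioms ac D(3)]
    by eventually_elim (auto simp: p_def top.not_eq_extremum)
  then have P: "P = density Q (\<lambda>x. ennreal (p x))"
    using Q.density_RN_deriv[OF ac D(3)]
      density_cong[of "RN_deriv Q P" Q "\<lambda>x. ennreal (p x)"] by simp
  define K where "K = exp (\<alpha> * ((\<alpha> - 1) * \<rho>))"
  \<comment> \<open>Test with \<open>p powr (\<alpha> - 1)\<close>; truncating \<open>p\<close> first makes the moment finite, so it can be divided out.\<close>
  have J: "(\<integral>\<^sup>+x. ennreal (min (p x) (real n) powr \<alpha>) \<partial>Q) \<le> ennreal K" for n
  proof -
    define q where "q x = min (p x) (real n)" for x
    have q0: "0 \<le> q x" "q x \<le> real n" for x using p0 by (auto simp: q_def)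
    have qm[measurable]: "q \<in> borel_measurable Q" unfolding q_def by measurable
    define J where "J = (\<integral>x. q x powr \<alpha> \<partial>Q)"
    have int: "integrable Q (\<lambda>x. q x powr \<alpha>)"
      by (rule integrable_bounded[OF Q.prob_space_axioms, where C = "real n powr \<alpha>"])
        (use powr_bounded[of q, OF q0] \<alpha> in auto)
    have b: "0 \<le> q x powr (\<alpha> - 1)" "q x powr (\<alpha> - 1) \<le> real n powr (\<alpha> - 1)" for x
      using powr_bounded[of q, OF q0] \<alpha> by auto
    have "integrable P (\<lambda>x. q x powr (\<alpha> - 1))"
      by (rule integrable_bounded[OF P.prob_space_axioms _ b]) (simp cong: measurable_cong_sets add: D(3))
    then have int': "integrable Q (\<lambda>x. p x * q x powr (\<alpha> - 1))"
      unfolding P by (subst (asm) integrable_density) (auto simp: p0)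
    have "J \<le> (\<integral>x. p x * q x powr (\<alpha> - 1) \<partial>Q)"
      unfolding J_def
    proof (rule integral_mono[OF int int'])
      fix x
      have "q x powr \<alpha> = q x * q x powr (\<alpha> - 1)"
        using q0(1)[of x] by (cases "q x = 0") (auto simp: powr_diff)
      also have "\<dots> \<le> p x * q x powr (\<alpha> - 1)"
        by (intro mult_right_mono) (auto simp: q_def)
      finally show "q x powr \<alpha> \<le> p x * q x powr (\<alpha> - 1)" .
    qed
    also have "\<dots> = (\<integral>x. q x powr (\<alpha> - 1) \<partial>P)"
      unfolding P by (subst integral_density) (auto simp: p0)
    also have "\<dots> \<le> exp ((\<alpha> - 1) * \<rho>) *
        (\<integral>x. (q x powr (\<alpha> - 1)) powr (\<alpha> / (\<alpha> - 1)) \<partial>Q) powr ((\<alpha> - 1) / \<alpha>)"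
      by (rule D(4)[OF _ b]) measurable
    \<comment> \<open>The conjugate exponent turns the test function back into
      \<open>q x powr \<alpha>\<close>, so \<open>J\<close> is bounded by a power of itself.\<close>
    also have "(\<integral>x. (q x powr (\<alpha> - 1)) powr (\<alpha> / (\<alpha> - 1)) \<partial>Q) = J"
      using \<alpha> by (simp add: J_def powr_powr)
    finally have "J \<le> K"
      unfolding K_def by (intro le_exp_of_self_bound \<alpha>) (simp_all add: J_def)
    moreover have "(\<integral>\<^sup>+x. ennreal (q x powr \<alpha>) \<partial>Q) = ennreal J"
      unfolding J_def by (rule nn_integral_eq_integral[OF int]) simp
    ultimately show ?thesis by (simp add: q_def ennreal_leI)
  qed
  have "(\<integral>\<^sup>+x. ennreal (p x powr \<alpha>) \<partial>Q) =
      (\<integral>\<^sup>+x. (SUP n. ennreal (min (p x) (real n) powr \<alpha>)) \<partial>Q)"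
  proof (intro nn_integral_cong)
    fix x
    obtain n where "p x \<le> real n" using real_arch_simple by blast
    then have n: "min (p x) (real n) = p x" by simp
    show "ennreal (p x powr \<alpha>) = (SUP n. ennreal (min (p x) (real n) powr \<alpha>))"
    proof (rule antisym)
      show "ennreal (p x powr \<alpha>) \<le> (SUP n. ennreal (min (p x) (real n) powr \<alpha>))"
        by (rule SUP_upper2[of n]) (simp_all add: n)
      show "(SUP n. ennreal (min (p x) (real n) powr \<alpha>)) \<le> ennreal (p x powr \<alpha>)"
        using p0 \<alpha> by (intro SUP_least ennreal_leI powr_mono2) auto
    qed
  qed
  also have "\<dots> = (SUP n. \<integral>\<^sup>+x. ennreal (min (p x) (real n) powr \<alpha>) \<partial>Q)"
    using p0 \<alpha> by (intro nn_integral_monotone_convergence_SUP)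
      (auto intro!: incseq_SucI le_funI ennreal_leI powr_mono2)
  also have "\<dots> \<le> ennreal K" by (intro SUP_least J)
  finally have I: "(\<integral>\<^sup>+x. ennreal (p x powr \<alpha>) \<partial>Q) \<le> ennreal K" .
  define I where "I = (\<integral>\<^sup>+x. ennreal (p x powr \<alpha>) \<partial>Q)"
  have fin: "I < \<infinity>" using I unfolding I_def by (metis ennreal_less_top infinity_ennreal_def le_less_trans)
  have "enn2real I \<le> K"
    using I fin by (simp add: I_def K_def enn2real_leI)
  \<comment> \<open>The zero case is settled by the convention that \<open>ln 0\<close> is 0,
    together with \<open>\<rho> \<ge> 0\<close>.\<close>
  then have "ln (enn2real I) \<le> (\<alpha> - 1) * (\<alpha> * \<rho>)"
  proof (cases "enn2real I = 0")
    case False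
    then have "0 < enn2real I" by (simp add: less_le)
    then have "ln (enn2real I) \<le> ln K" using \<open>enn2real I \<le> K\<close> by simp
    then show ?thesis by (simp add: K_def mult.left_commute)
  qed (use \<alpha> \<rho> in simp)
  then have "ln (enn2real I) / (\<alpha> - 1) \<le> \<alpha> * \<rho>"
    using \<alpha> by (simp add: pos_divide_le_eq mult.commute)
  then show ?thesis
    using ac fin by (simp add: renyi_divergence_def Let_def I_def p_def)
qed

text \<open>With \<open>d\<close> the additive term, the factor
  \<open>exp ((\<alpha> - 1) * \<rho>)\<close> splits so that the bound on
  \<open>measure P S\<close> becomes the geometric mean of \<open>d\<close> and
  \<open>exp \<epsilon> * measure Q S\<close> with weights \<open>1 / \<alpha>\<close> and
  \<open>(\<alpha> - 1) / \<alpha>\<close>. Such a mean is at most the maximum \<open>m\<close>,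
  hence at most the sum.\<close>

lemma renyi_dominated_imp_approx_dp:
  assumes \<alpha>: "\<alpha> > 1" and dom: "renyi_dominated \<alpha> \<rho> P Q" and S: "S \<in> sets P"
  shows "measure P S \<le> exp \<epsilon> * measure Q S + exp ((\<alpha> - 1) * (\<alpha> * \<rho> - \<epsilon>))"
proof -
  define d where "d = exp ((\<alpha> - 1) * (\<alpha> * \<rho> - \<epsilon>))"
  define m where "m = max d (exp \<epsilon> * measure Q S)"
  have m: "0 < m" "d \<le> m" "exp \<epsilon> * measure Q S \<le> m"
    by (auto simp: m_def d_def less_max_iff_disj)
  have "measure P S \<le> exp ((\<alpha> - 1) * \<rho>) * measure Q S powr ((\<alpha> - 1) / \<alpha>)"
    by (rule renyi_dominated_measure[OF dom S])
  also have "exp ((\<alpha> - 1) * \<rho>) = d powr (1 / \<alpha>) * exp \<epsilon> powr ((\<alpha> - 1) / \<alpha>)"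
  proof -
    have "(\<alpha> - 1) * \<rho> = ((\<alpha> - 1) * (\<alpha> * \<rho> - \<epsilon>)) * (1 / \<alpha>) + \<epsilon> * ((\<alpha> - 1) / \<alpha>)"
      using \<alpha> by (simp add: field_simps)
    then have "exp ((\<alpha> - 1) * \<rho>) =
        exp (((\<alpha> - 1) * (\<alpha> * \<rho> - \<epsilon>)) * (1 / \<alpha>)) * exp (\<epsilon> * ((\<alpha> - 1) / \<alpha>))"
      by (simp only: exp_add)
    then show ?thesis by (simp only: d_def exp_powr_real)
  qed
  also have "d powr (1 / \<alpha>) * exp \<epsilon> powr ((\<alpha> - 1) / \<alpha>) * measure Q S powr ((\<alpha> - 1) / \<alpha>) =
      d powr (1 / \<alpha>) * (exp \<epsilon> * measure Q S) powr ((\<alpha> - 1) / \<alpha>)"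
    by (simp add: powr_mult)
  also have "\<dots> \<le> m powr (1 / \<alpha>) * m powr ((\<alpha> - 1) / \<alpha>)"
    using \<alpha> m by (intro mult_mono powr_mono2) (auto simp: d_def)
  also have "\<dots> = m"
  proof -
    have "1 / \<alpha> + (\<alpha> - 1) / \<alpha> = 1" using \<alpha> by (simp add: field_simps)
    then show ?thesis using m powr_add[of m "1 / \<alpha>" "(\<alpha> - 1) / \<alpha>"] by simp
  qed
  also have "m \<le> exp \<epsilon> * measure Q S + d"
    by (simp add: m_def d_def)
  finally show ?thesis by (simp add: d_def)
qed

text \<open>The order \<open>\<alpha> = (\<epsilon> + \<rho>) / (2 * \<rho>)\<close> minimizes the exponent \<open>(\<alpha> - 1) * (\<alpha> * \<rho> - \<epsilon>)\<close>; its minimum is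
  \<open>- (\<epsilon> - \<rho>)\<^sup>2 / (4 * \<rho>)\<close>.\<close>

lemma differentially_private_of_renyi_dominated:
  assumes dom: "\<And>D D' \<alpha>. nbr D D' \<Longrightarrow> \<alpha> > 1 \<Longrightarrow> renyi_dominated \<alpha> \<rho> (M D) (M D')"
    and \<rho>: "0 < \<rho>" and \<epsilon>: "0 < \<epsilon>" and \<delta>: "0 < \<delta>" "\<delta> < 1"
    and le: "4 * \<rho> * (ln (1 / \<delta>) + \<epsilon>) \<le> \<epsilon>\<^sup>2"
  shows "differentially_private nbr M \<epsilon> \<delta>"
  unfolding differentially_private_def
proof (intro allI impI ballI)
  fix D D' S
  assume nbr: "nbr D D'" and S: "S \<in> sets (M D)"
  have L: "ln (1 / \<delta>) > 0" using \<delta> by simp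
  \<comment> \<open>The noise condition forces \<rho> below \<epsilon>, which is exactly what puts
    the optimal order above 1.\<close>
  have "4 * \<rho> * \<epsilon> < 4 * \<rho> * (ln (1 / \<delta>) + \<epsilon>)" using L \<rho> by simp
  also note le
  finally have "4 * \<rho> < \<epsilon>" using \<epsilon> by (simp add: power2_eq_square)
  then have "\<rho> < \<epsilon>" using \<rho> by simp
  define \<alpha> where "\<alpha> = (\<epsilon> + \<rho>) / (2 * \<rho>)"
  have \<alpha>: "\<alpha> > 1" using \<open>\<rho> < \<epsilon>\<close> \<rho> by (simp add: \<alpha>_def)
  have "(\<alpha> - 1) * (\<alpha> * \<rho> - \<epsilon>) = - (\<epsilon> - \<rho>)\<^sup>2 / (4 * \<rho>)"
    using \<rho> by (simp add: \<alpha>_def field_simps power2_eq_square)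
  also have "\<dots> \<le> - ln (1 / \<delta>)"
  proof -
    have "4 * \<rho> * ln (1 / \<delta>) \<le> \<epsilon>\<^sup>2 - 4 * \<rho> * \<epsilon>" using le by (simp add: algebra_simps)
    \<comment> \<open>The summand \<epsilon> next to the logarithm in \<open>le\<close> pays for the
      cross term of the square; the slack is
      \<open>2 * \<rho> * \<epsilon> + \<rho>\<^sup>2\<close>.\<close>
    also have "\<dots> \<le> (\<epsilon> - \<rho>)\<^sup>2"
      using \<rho> \<epsilon> by (simp add: power2_diff)
    finally show ?thesis using \<rho> by (simp add: field_simps)
  qed
  also have "- ln (1 / \<delta>) = ln \<delta>" using \<delta> by (simp add: ln_div)
  finally have "exp ((\<alpha> - 1) * (\<alpha> * \<rho> - \<epsilon>)) \<le> \<delta>"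
    using \<delta> by (simp add: ln_ge_iff)
  with renyi_dominated_imp_approx_dp[OF \<alpha> dom[OF nbr \<alpha>] S, of \<epsilon>]
  show "measure (M D) S \<le> exp \<epsilon> * measure (M D') S + \<delta>" by linarith
qed

section \<open>Linear algebra of the update\<close>

lemma norm_clip_le: "c \<ge> 0 \<Longrightarrow> norm (clip v c) \<le> c"
  by (cases "v = 0") (auto simp: clip_def min_def field_simps)

lemma norm_outer: "norm (outer x y) = norm x * norm y"
proof -
  have "(norm (outer x y))\<^sup>2 = (\<Sum>i\<in>UNIV. \<Sum>j\<in>UNIV. (x $ i)\<^sup>2 * (y $ j)\<^sup>2)"
    by (simp add: norm_vec_def L2_set_def sum_nonneg outer_def power_mult_distrib)
  also have "\<dots> = (norm x * norm y)\<^sup>2"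
    by (simp add: norm_vec_def L2_set_def sum_nonneg power_mult_distrib sum_product)
  finally show ?thesis by (simp add: power2_eq_iff_nonneg)
qed

lemma norm_kronecker: "norm (kronecker A B) = norm A * norm B"
proof -
  have "(norm (kronecker A B))\<^sup>2 =
      (\<Sum>p\<in>UNIV \<times> UNIV. \<Sum>q\<in>UNIV \<times> UNIV. (A $ fst p $ fst q)\<^sup>2 * (B $ snd p $ snd q)\<^sup>2)"
    by (simp add: norm_vec_def L2_set_def sum_nonneg kronecker_def power_mult_distrib)
  also have "\<dots> = (\<Sum>i\<in>UNIV. \<Sum>k\<in>UNIV. \<Sum>j\<in>UNIV. \<Sum>l\<in>UNIV. (A $ i $ j)\<^sup>2 * (B $ k $ l)\<^sup>2)"
    by (simp only: sum.Sigma[symmetric] finite fst_conv snd_conv sum.cartesian_product' ball_simps)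
  also have "\<dots> = (\<Sum>i\<in>UNIV. \<Sum>j\<in>UNIV. (A $ i $ j)\<^sup>2) * (\<Sum>k\<in>UNIV. \<Sum>l\<in>UNIV. (B $ k $ l)\<^sup>2)"
    by (simp add: sum_product)
  also have "\<dots> = (norm A * norm B)\<^sup>2"
    by (simp add: norm_vec_def L2_set_def sum_nonneg power_mult_distrib)
  finally show ?thesis by (simp add: power2_eq_iff_nonneg)
qed

lemma matrix_inv_mult_vec_eq_iff:
  fixes A :: "real^'n::finite^'n"
  assumes "det A \<noteq> 0"
  shows "matrix_inv A *v b = x \<longleftrightarrow> A *v x = b"
proof -
  have "\<exists>B. A ** B = mat 1 \<and> B ** A = mat 1"
    using assms by (simp add: invertible_det_nz[symmetric] invertible_def)
  then have inv: "A ** matrix_inv A = mat 1" "matrix_inv A ** A = mat 1"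
    unfolding matrix_inv_def by (rule someI2_ex; simp)+
  show ?thesis
    by (metis inv matrix_vector_mul_assoc matrix_vector_mul_lid)
qed

lemma matrix_inv_scaleR_mult_vec:
  fixes A :: "real^'n::finite^'n"
  assumes "det A \<noteq> 0" "k \<noteq> 0"
  shows "matrix_inv (k *\<^sub>R A) *v (k *\<^sub>R b) = matrix_inv A *v b"
proof -
  have "det (k *\<^sub>R A) \<noteq> 0"
    using assms scalar_invertible[of k A] by (simp add: invertible_det_nz)
  moreover have "A *v (matrix_inv A *v b) = b"
    using matrix_inv_mult_vec_eq_iff[OF assms(1), of b "matrix_inv A *v b"] by simp
  ultimately show ?thesis
    by (simp add: matrix_inv_mult_vec_eq_iff scaleR_matrix_vector_assoc[symmetric])
qed

text \<open>Singular matrices are all sent by \<^const>\<open>matrix_inv\<close> to the same junk value, and on the others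
  Cramer's rule applies.\<close>

lemma borel_measurable_matrix_inv_mult_vec[measurable (raw)]:
  fixes A :: "'x \<Rightarrow> real^'n::finite^'n"
  assumes [measurable]: "A \<in> borel_measurable M" "b \<in> borel_measurable M"
  shows "(\<lambda>x. matrix_inv (A x) *v b x) \<in> borel_measurable M"
proof -
  define K :: "real^'n^'n" where "K = (SOME B. False)"
  have sing: "matrix_inv B = K" if "det B = 0" for B :: "real^'n^'n"
  proof -
    have "\<not> invertible B" using that by (simp add: invertible_det_nz)
    then have "(\<lambda>C. B ** C = mat 1 \<and> C ** B = mat 1) = (\<lambda>C. False)"
      by (auto simp: invertible_def fun_eq_iff)
    then show ?thesis unfolding matrix_inv_def K_def by simp
  qed
  have eq: "matrix_inv (A x) *v b x =
      (if det (A x) = 0 then K *v b x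
       else (\<chi> k. det (\<chi> i j. if j = k then b x $ i else A x $ i $ j) / det (A x)))" for x
    using cramer[of "A x"] matrix_inv_mult_vec_eq_iff[of "A x"] by (auto simp: sing)
  have [measurable]: "(\<lambda>x. K *v b x) \<in> borel_measurable M"
    unfolding matrix_vector_mult_def by measurable
  have [measurable]: "(\<lambda>x. if j = k then b x $ i else A x $ i $ j) \<in> borel_measurable M" for i j k
    by (cases "j = k") simp_all
  show ?thesis unfolding eq by measurable
qed

lemma distr_pair_gaussian_shift:
  fixes S1 :: "real^'k::finite^'n::finite" and S2 :: "real^'m::finite^'p::finite"
  assumes "v1 > 0" "v2 > 0"
  shows "distr (gaussian_matrix v1 \<Otimes>\<^sub>M gaussian_matrix v2) borel ((+) (S1, S2)) =
    distr (gaussian_matrix v1) borel ((+) S1) \<Otimes>\<^sub>M distr (gaussian_matrix v2) borel ((+) S2)"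
proof -
  interpret G1: prob_space "gaussian_matrix v1 :: (real^'k^'n) measure"
    using assms(1) by (rule prob_space_gaussian_matrix)
  interpret G2: prob_space "gaussian_matrix v2 :: (real^'m^'p) measure"
    using assms(2) by (rule prob_space_gaussian_matrix)
  interpret D2: prob_space "distr (gaussian_matrix v2) borel ((+) S2)"
    by (rule G2.prob_space_distr) simp
  have "distr (gaussian_matrix v1) borel ((+) S1) \<Otimes>\<^sub>M distr (gaussian_matrix v2) borel ((+) S2) =
      distr (gaussian_matrix v1 \<Otimes>\<^sub>M gaussian_matrix v2) (borel \<Otimes>\<^sub>M borel) (\<lambda>(x, y). (S1 + x, S2 + y))"
    by (rule pair_measure_distr) (simp_all add: D2.sigma_finite_measure_axioms)
  also have "\<dots> = distr (gaussian_matrix v1 \<Otimes>\<^sub>M gaussian_matrix v2) borel ((+) (S1, S2))"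
    by (intro distr_cong) (simp_all only: borel_prod, simp_all add: plus_prod_def case_prod_beta)
  finally show ?thesis ..
qed

lemma sets_pair_gaussian_matrix:
  "sets (gaussian_matrix v1 \<Otimes>\<^sub>M gaussian_matrix v2) = sets borel"
  by (subst borel_prod[symmetric]) (intro sets_pair_measure_cong, simp_all)

lemma prob_space_pair_gaussian_matrix:
  assumes "v1 > 0" "v2 > 0"
  shows "prob_space (gaussian_matrix v1 \<Otimes>\<^sub>M gaussian_matrix v2)"
  using assms by (intro prob_space_pair prob_space_gaussian_matrix)

text \<open>Only the difference of the shifts matters: the noise moved by \<open>S - T\<close> is
  compared with the unshifted noise, and both are then pushed forward along translation by
  \<open>T\<close>.\<close>

lemma renyi_dominated_pair_gaussian_shifts:
  fixes S1 T1 :: "real^'k::finite^'n::finite" and S2 T2 :: "real^'m::finite^'p::finite"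
  assumes \<alpha>: "\<alpha> > 1" and v: "v1 > 0" "v2 > 0"
  defines "\<nu> \<equiv> gaussian_matrix v1 \<Otimes>\<^sub>M gaussian_matrix v2"
  shows "renyi_dominated \<alpha> ((norm (S1 - T1))\<^sup>2 / (2 * v1) + (norm (S2 - T2))\<^sup>2 / (2 * v2))
    (distr \<nu> borel ((+) (S1, S2))) (distr \<nu> borel ((+) (T1, T2)))"
proof -
  have T: "(+) (T1, T2) \<in> measurable \<nu> borel"
    unfolding \<nu>_def measurable_cong_sets[OF sets_pair_gaussian_matrix refl] by simp
  have D: "(+) (S1 - T1, S2 - T2) \<in> measurable \<nu> borel"
    unfolding \<nu>_def measurable_cong_sets[OF sets_pair_gaussian_matrix refl] by simp
  have "renyi_dominated \<alpha> ((norm (S1 - T1))\<^sup>2 / (2 * v1) + (norm (S2 - T2))\<^sup>2 / (2 * v2))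
      (distr \<nu> borel ((+) (S1 - T1, S2 - T2))) \<nu>"
    unfolding \<nu>_def distr_pair_gaussian_shift[OF v]
    by (intro renyi_dominated_pair renyi_dominated_gaussian_matrix_shift \<alpha> v)
  from renyi_dominated_distr[OF this T] show ?thesis
    using D by (subst (asm) distr_distr) (auto simp: comp_def add.assoc[symmetric])
qed

section \<open>The published matrices\<close>

text \<open>The private vectors depend on the noise only through the published matrices \<open>h\<close>. Without this
  the iterations would not compose adaptively.\<close>

primrec user_vectors ::
    "('i, 's, 'd::finite, 'r::finite) amht_input \<Rightarrow> ('i, 's, 'd) dataset \<Rightarrow> (nat \<Rightarrow> real^'r^'d) \<Rightarrow> nat \<Rightarrow>
     ('i \<Rightarrow> real^'r) \<times> ('i \<Rightarrow> real^'d)" where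
  "user_vectors c D h 0 = ((\<lambda>i. init_w c i (the (D i))), (\<lambda>i. init_b c i (the (D i))))"
| "user_vectors c D h (Suc l) =
     (let (w, b) = user_vectors c D h l;
          U = (if l = 0 then init_U c else h l);
          b' = (\<lambda>i. sparse_step c (Suc l) (the (D i)) (U *v w i) (b i))
      in ((\<lambda>i. ls_step c (Suc l) (the (D i)) U (b' i)), b'))"

text \<open>One iteration as a function of the published history and the fresh noise alone; its law
  for fixed \<open>h\<close> is the kernel of the composition.\<close>

definition shared_update ::
    "('i, 's, 'd::finite, 'r::finite) amht_input \<Rightarrow> ('i, 's, 'd) dataset \<Rightarrow> nat \<Rightarrow> (nat \<Rightarrow> real^'r^'d) \<Rightarrow>
     (real^('r \<times> 'd)^('r \<times> 'd)) \<times> (real^'r^'d) \<Rightarrow> real^'r^'d" where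
  "shared_update c D l h y =
     (let (w, b) = user_vectors c D h l
      in qr c (unstack_columns (matrix_inv (amht_A c D l w (fst y)) *v
           stack_columns (amht_V c D l w b (snd y)))))"

definition published_upto ::
    "('i, 's, 'd::finite, 'r::finite) amht_input \<Rightarrow> ('i, 's, 'd) dataset \<Rightarrow> nat \<Rightarrow> ('d, 'r) noise \<Rightarrow>
     nat \<Rightarrow> real^'r^'d" where
  "published_upto c D n N = (\<lambda>l\<in>{1..n}. fst (amht_state c D N l))"

text \<open>Only strictly earlier published matrices are read, so the law of the next matrix is
  determined by what is already public.\<close>

lemma user_vectors_cong:
  "(\<And>k. 0 < k \<Longrightarrow> k < l \<Longrightarrow> h k = h' k) \<Longrightarrow> user_vectors c D h l = user_vectors c D h' l"
  by (induction l) (auto simp: Let_def)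

text \<open>Users interact only through the shared matrices: for a fixed history, nobody else's data
  enters. Neighbouring data sets therefore differ in a single summand.\<close>

lemma user_vectors_user_cong:
  assumes "D i = D' i"
  shows "fst (user_vectors c D h l) i = fst (user_vectors c D' h l) i \<and>
    snd (user_vectors c D h l) i = snd (user_vectors c D' h l) i"
  by (induction l) (auto simp: Let_def case_prod_beta assms)

lemma snd_amht_state:
  "snd (amht_state c D N l) = user_vectors c D (\<lambda>k. fst (amht_state c D N k)) l"
proof (induction l)
  case (Suc l)
  obtain U w b where *: "amht_state c D N l = (U, w, b)" by (cases "amht_state c D N l")
  \<comment> \<open>Histories are indexed from 1; index 0 is the fixed initial matrix, which is not
    read from the history.\<close>
  have "U = (if l = 0 then init_U c else fst (amht_state c D N l))"
    using * by (cases l) auto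
  moreover have "user_vectors c D (\<lambda>k. fst (amht_state c D N k)) l = (w, b)"
    using Suc.IH * by simp
  ultimately show ?case by (simp add: * Let_def)
qed simp

lemma fst_amht_state_Suc:
  "fst (amht_state c D N (Suc l)) = shared_update c D (Suc l) (published_upto c D l N) (N (Suc l))"
proof -
  have "user_vectors c D (published_upto c D l N) (Suc l) =
      user_vectors c D (\<lambda>k. fst (amht_state c D N k)) (Suc l)"
    by (rule user_vectors_cong) (auto simp: published_upto_def)
  also have "\<dots> = snd (amht_state c D N (Suc l))"
    by (rule snd_amht_state[symmetric])
  finally show ?thesis
    by (simp add: shared_update_def Let_def case_prod_beta del: user_vectors.simps)
qed

lemma published_upto_Suc:
  "published_upto c D (Suc n) N =
    (published_upto c D n N)(Suc n := shared_update c D (Suc n) (published_upto c D n N) (N (Suc n)))"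
  using fst_amht_state_Suc[of c D N n]
  by (auto simp: published_upto_def fun_eq_iff le_Suc_eq simp del: amht_state.simps)

lemma published_upto_cong:
  "(\<And>l. 0 < l \<Longrightarrow> l \<le> n \<Longrightarrow> N l = N' l) \<Longrightarrow> published_upto c D n N = published_upto c D n N'"
proof (induction n)
  case 0
  show ?case by (simp add: published_upto_def)
next
  case (Suc n)
  then have "published_upto c D n N = published_upto c D n N'" by simp
  then show ?case using Suc.prems[of "Suc n"] by (simp add: published_upto_Suc)
qed

section \<open>Measurability of the update in the history and the noise\<close>

lemma borel_measurable_fst_snd:
  assumes "f \<in> borel_measurable M"
  shows "(\<lambda>x. fst (f x)) \<in> borel_measurable M" "(\<lambda>x. snd (f x)) \<in> borel_measurable M"
  by (auto intro!: measurable_compose[OF assms] borel_measurable_continuous_onI continuous_intros)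

lemma borel_measurable_stack_columns[measurable]: "stack_columns \<in> borel_measurable borel"
  unfolding stack_columns_def by measurable

lemma borel_measurable_unstack_columns[measurable]: "unstack_columns \<in> borel_measurable borel"
  unfolding unstack_columns_def by measurable

lemma borel_measurable_outer[measurable (raw)]:
  assumes [measurable]: "f \<in> borel_measurable M" "g \<in> borel_measurable M"
  shows "(\<lambda>x. outer (f x) (g x)) \<in> borel_measurable M"
  unfolding outer_def by measurable

lemma borel_measurable_kronecker[measurable (raw)]:
  assumes [measurable]: "f \<in> borel_measurable M" "g \<in> borel_measurable M"
  shows "(\<lambda>x. kronecker (f x) (g x)) \<in> borel_measurable M"
  unfolding kronecker_def by measurable

lemma borel_measurable_clip[measurable (raw)]:
  fixes f :: "'x \<Rightarrow> 'v::euclidean_space"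
  assumes [measurable]: "f \<in> borel_measurable M"
  shows "(\<lambda>x. clip (f x) c) \<in> borel_measurable M"
  unfolding clip_def by measurable

lemma borel_measurable_matrix_vector_mult[measurable (raw)]:
  fixes A :: "'x \<Rightarrow> real^'n::finite^'m::finite"
  assumes [measurable]: "A \<in> borel_measurable M" "b \<in> borel_measurable M"
  shows "(\<lambda>x. A x *v b x) \<in> borel_measurable M"
  unfolding matrix_vector_mult_def by measurable

text \<open>Stated for one user at a time, which avoids a sigma-algebra on functions of the user
  identifiers.\<close>

lemma measurable_user_vectors:
  fixes c :: "('i, 's::finite, 'd::finite, 'r::{finite,linorder}) amht_input"
  assumes wf: "amht_wf c"
    and h[measurable]: "\<And>k. 0 < k \<Longrightarrow> k < l \<Longrightarrow> (\<lambda>x. h x k) \<in> borel_measurable M"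
  shows "(\<lambda>x. fst (user_vectors c D (h x) l) i) \<in> borel_measurable M"
    and "(\<lambda>x. snd (user_vectors c D (h x) l) i) \<in> borel_measurable M"
proof -
  have sp[measurable (raw)]: "(\<lambda>x. sparse_step c k X (f x) (g x)) \<in> borel_measurable M"
    if "f \<in> borel_measurable M" "g \<in> borel_measurable M" for k X f g
    using wf measurable_compose[of "\<lambda>x. (f x, g x)" M borel "\<lambda>(v, b). sparse_step c k X v b" borel] that
    by (auto simp: amht_wf_def borel_measurable_Pair)
  have ls[measurable (raw)]: "(\<lambda>x. ls_step c k X (f x) (g x)) \<in> borel_measurable M"
    if "f \<in> borel_measurable M" "g \<in> borel_measurable M" for k X f g
    using wf measurable_compose[of "\<lambda>x. (f x, g x)" M borel "\<lambda>(v, b). ls_step c k X v b" borel] that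
    by (auto simp: amht_wf_def borel_measurable_Pair)
  have "(\<forall>i. (\<lambda>x. fst (user_vectors c D (h x) n) i) \<in> borel_measurable M \<and>
      (\<lambda>x. snd (user_vectors c D (h x) n) i) \<in> borel_measurable M)" if "n \<le> l" for n
    using that
  proof (induction n)
    case (Suc n)
    then have IH[measurable]:
      "\<And>i. (\<lambda>x. fst (user_vectors c D (h x) n) i) \<in> borel_measurable M"
      "\<And>i. (\<lambda>x. snd (user_vectors c D (h x) n) i) \<in> borel_measurable M"
      by auto
    have U[measurable]: "(\<lambda>x. if n = 0 then init_U c else h x n) \<in> borel_measurable M"
      using h[of n] Suc.prems by (cases "n = 0") auto
    show ?case
      by (simp only: user_vectors.simps Let_def case_prod_beta fst_conv snd_conv) measurable
  qed simp
  then show "(\<lambda>x. fst (user_vectors c D (h x) l) i) \<in> borel_measurable M"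
    "(\<lambda>x. snd (user_vectors c D (h x) l) i) \<in> borel_measurable M"
    by auto
qed

lemma measurable_shared_update:
  fixes c :: "('i, 's::finite, 'd::finite, 'r::{finite,linorder}) amht_input"
  assumes wf: "amht_wf c"
    and h: "\<And>k. 0 < k \<Longrightarrow> k < l \<Longrightarrow> (\<lambda>x. h x k) \<in> borel_measurable M"
    and y[measurable]: "y \<in> borel_measurable M"
  shows "(\<lambda>x. shared_update c D l (h x) (y x)) \<in> borel_measurable M"
proof -
  note measurable_user_vectors[OF wf h, measurable]
  have qr[measurable]: "qr c \<in> borel_measurable borel"
    using wf by (simp add: amht_wf_def)
  note [measurable] = borel_measurable_fst_snd[OF y]
  show ?thesis
    unfolding shared_update_def Let_def case_prod_beta amht_A_def amht_V_def
    by measurable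
qed

section \<open>Contribution of a single user and sensitivity of the sums\<close>

definition user_A ::
    "('i, 's, 'd::finite, 'r::finite) amht_input \<Rightarrow> nat \<Rightarrow> ('s, 'd) samples \<Rightarrow> real^'r \<Rightarrow>
     real^('r \<times> 'd)^('r \<times> 'd)" where
  "user_A c l X w = kronecker (outer (clip w (clip_w c)) (clip w (clip_w c)))
     (\<Sum>j\<in>batch c l. outer (clip (fst (X j)) (clip_x c)) (clip (fst (X j)) (clip_x c)))"

definition user_V ::
    "('i, 's, 'd::finite, 'r::finite) amht_input \<Rightarrow> nat \<Rightarrow> ('s, 'd) samples \<Rightarrow> real^'r \<Rightarrow> real^'d \<Rightarrow>
     real^'r^'d" where
  "user_V c l X w b = (\<Sum>j\<in>batch c l.
     (clip (snd (X j)) (clip_y c) - clip (fst (X j) \<bullet> b) (clip_q c)) *\<^sub>R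
       outer (clip (fst (X j)) (clip_x c)) (clip w (clip_w c)))"

lemma norm_user_A_le:
  assumes "clip_x c \<ge> 0" "clip_w c \<ge> 0"
  shows "norm (user_A c l X w) \<le> real (card (batch c l)) * (clip_x c)\<^sup>2 * (clip_w c)\<^sup>2"
proof -
  have "norm (user_A c l X w) = norm (clip w (clip_w c)) * norm (clip w (clip_w c)) *
      norm (\<Sum>j\<in>batch c l. outer (clip (fst (X j)) (clip_x c)) (clip (fst (X j)) (clip_x c)))"
    by (simp add: user_A_def norm_kronecker norm_outer)
  also have "\<dots> \<le> clip_w c * clip_w c * (\<Sum>j\<in>batch c l. clip_x c * clip_x c)"
    using assms
    by (intro mult_mono norm_clip_le sum_norm_le)
      (auto simp: norm_outer intro!: mult_mono norm_clip_le)
  finally show ?thesis by (simp add: power2_eq_square algebra_simps)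
qed

lemma norm_user_V_le:
  assumes "clip_x c \<ge> 0" "clip_w c \<ge> 0" "clip_y c \<ge> 0" "clip_q c \<ge> 0"
  shows "norm (user_V c l X w b) \<le>
    real (card (batch c l)) * clip_x c * (clip_y c + clip_q c) * clip_w c"
proof -
  have "norm (user_V c l X w b) \<le>
      (\<Sum>j\<in>batch c l. (clip_y c + clip_q c) * (clip_x c * clip_w c))"
    unfolding user_V_def
  proof (rule sum_norm_le)
    fix j
    have "\<bar>clip (snd (X j)) (clip_y c) - clip (fst (X j) \<bullet> b) (clip_q c)\<bar> \<le> clip_y c + clip_q c"
      using norm_clip_le[of "clip_y c" "snd (X j)"] norm_clip_le[of "clip_q c" "fst (X j) \<bullet> b"] assms
      by simp
    then show "norm ((clip (snd (X j)) (clip_y c) - clip (fst (X j) \<bullet> b) (clip_q c)) *\<^sub>R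
       outer (clip (fst (X j)) (clip_x c)) (clip w (clip_w c))) \<le>
       (clip_y c + clip_q c) * (clip_x c * clip_w c)"
      using assms by (simp add: norm_outer) (intro mult_mono norm_clip_le; simp)
  qed
  then show ?thesis by (simp add: algebra_simps)
qed

text \<open>Noise-free and without the factor 1/(mt), so that neighbouring data sets are compared on
  the same scale.\<close>

definition amht_sums ::
    "('i, 's, 'd::finite, 'r::finite) amht_input \<Rightarrow> ('i, 's, 'd) dataset \<Rightarrow> nat \<Rightarrow> (nat \<Rightarrow> real^'r^'d) \<Rightarrow>
     (real^('r \<times> 'd)^('r \<times> 'd)) \<times> (real^'r^'d)" where
  "amht_sums c D l h =
     ((\<Sum>i\<in>dom D. user_A c l (the (D i)) (fst (user_vectors c D h l) i)),
      (\<Sum>i\<in>dom D. user_V c l (the (D i)) (fst (user_vectors c D h l) i) (snd (user_vectors c D h l) i)))"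

text \<open>For a fixed history the other users keep their vectors, so their summands are unchanged.
  The new user's vectors may stay existential, since clipping bounds the contribution whatever they
  are.\<close>

lemma amht_sums_add_user:
  assumes "finite (dom D)" "i \<notin> dom D"
  shows "\<exists>w b. amht_sums c (D(i \<mapsto> X)) l h = amht_sums c D l h + (user_A c l X w, user_V c l X w b)"
proof -
  let ?D = "D(i \<mapsto> X)"
  have eq: "fst (user_vectors c ?D h l) k = fst (user_vectors c D h l) k"
    "snd (user_vectors c ?D h l) k = snd (user_vectors c D h l) k" if "k \<in> dom D" for k
  proof -
    have "?D k = D k" using that assms(2) by auto
    then show "fst (user_vectors c ?D h l) k = fst (user_vectors c D h l) k"
      "snd (user_vectors c ?D h l) k = snd (user_vectors c D h l) k"
      using user_vectors_user_cong[of ?D k D c h l] by auto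
  qed
  have D: "?D k = D k" if "k \<in> dom D" for k
    using that assms(2) by auto
  have dom: "dom ?D = insert i (dom D)" by simp
  have "(\<Sum>k\<in>dom D. user_A c l (the (?D k)) (fst (user_vectors c ?D h l) k)) =
      (\<Sum>k\<in>dom D. user_A c l (the (D k)) (fst (user_vectors c D h l) k))"
    by (rule sum.cong) (simp_all only: eq D)
  moreover have "(\<Sum>k\<in>dom D. user_V c l (the (?D k)) (fst (user_vectors c ?D h l) k)
        (snd (user_vectors c ?D h l) k)) =
      (\<Sum>k\<in>dom D. user_V c l (the (D k)) (fst (user_vectors c D h l) k) (snd (user_vectors c D h l) k))"
    by (rule sum.cong) (simp_all only: eq D)
  ultimately show ?thesis
    unfolding amht_sums_def dom using assms
    by (simp add: add.commute) blast
qed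

text \<open>The normalization by the number of users, which differs between neighbouring data sets, cancels
  as soon as the noisy matrix is invertible.\<close>

lemma shared_update_eq:
  fixes c :: "('i, 's::finite, 'd::finite, 'r::{finite,linorder}) amht_input"
  assumes wf: "amht_wf c" and D: "is_dataset D"
    and det: "det (fst (amht_sums c D l h) + fst y) \<noteq> 0"
  shows "shared_update c D l h y =
    qr c (unstack_columns (matrix_inv (fst (amht_sums c D l h + y)) *v
      stack_columns (snd (amht_sums c D l h + y))))"
proof -
  define k where "k = 1 / (real (batch_size c) * real (card (dom D)))"
  have "card (dom D) > 0" using D by (simp add: is_dataset_def card_gt_0_iff)
  then have k: "k \<noteq> 0" using wf by (simp add: k_def amht_wf_def)
  obtain w b where wb: "user_vectors c D h l = (w, b)" by force
  have A: "amht_A c D l w (fst y) = k *\<^sub>R fst (amht_sums c D l h + y)"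
    by (simp add: amht_A_def amht_sums_def user_A_def wb k_def Let_def)
  have V: "amht_V c D l w b (snd y) = k *\<^sub>R snd (amht_sums c D l h + y)"
    by (simp add: amht_V_def amht_sums_def user_V_def wb k_def Let_def)
  have stack: "stack_columns (k *\<^sub>R B) = k *\<^sub>R stack_columns B" for B :: "((real, 'r) vec, 'd) vec"
    by (simp add: stack_columns_def vec_eq_iff)
  show ?thesis
    using det k by (simp add: shared_update_def wb A V stack matrix_inv_scaleR_mult_vec)
qed

text \<open>Squared sensitivity of the sum times the number of iterations times the squared
  multiplier; the fourth powers are squares of squared clipping levels.\<close>

definition A_variance :: "('i, 's, 'd::finite, 'r::finite) amht_input \<Rightarrow> real" where
  "A_variance c = (real (batch_size c))\<^sup>2 * clip_x c ^ 4 * clip_w c ^ 4 * real (iterations c) * (noise_mult c)\<^sup>2"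

definition V_variance :: "('i, 's, 'd::finite, 'r::finite) amht_input \<Rightarrow> real" where
  "V_variance c = (real (batch_size c))\<^sup>2 * (clip_x c)\<^sup>2 * (clip_y c + clip_q c)\<^sup>2 * (clip_w c)\<^sup>2 *
     real (iterations c) * (noise_mult c)\<^sup>2"

definition step_noise ::
    "('i, 's, 'd::finite, 'r::finite) amht_input \<Rightarrow> (((real, 'r \<times> 'd) vec, 'r \<times> 'd) vec \<times> ((real, 'r) vec, 'd) vec) measure" where
  "step_noise c = gaussian_matrix (A_variance c) \<Otimes>\<^sub>M gaussian_matrix (V_variance c)"

lemma noise_law_eq: "noise_law c = (\<Pi>\<^sub>M l\<in>{1..iterations c}. step_noise c)"
  by (simp add: noise_law_def step_noise_def A_variance_def V_variance_def Let_def)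

lemma sets_step_noise[simp, measurable_cong]: "sets (step_noise c) = sets borel"
  by (simp add: step_noise_def sets_pair_gaussian_matrix)

lemma sensitivity_bound:
  assumes "norm x \<le> s" "v = s\<^sup>2 * L * \<sigma>\<^sup>2" "0 < s" "0 < L" "0 < \<sigma>"
  shows "(norm x)\<^sup>2 / (2 * v) \<le> 1 / (2 * L * \<sigma>\<^sup>2)"
proof -
  have "(norm x)\<^sup>2 \<le> s\<^sup>2" using assms(1) by (intro power_mono) auto
  then show ?thesis using assms by (simp add: field_simps)
qed

context
  fixes c :: "('i, 's::finite, 'd::finite, 'r::{finite,linorder}) amht_input"
  assumes wf: "amht_wf c"
    and clips: "clip_x c > 0" "clip_y c > 0" "clip_q c > 0" "clip_w c > 0"
    and \<sigma>: "noise_mult c > 0"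
    and iters: "iterations c > 0"
begin

lemma variances_pos: "A_variance c > 0" "V_variance c > 0"
  using wf clips \<sigma> iters by (simp_all add: A_variance_def V_variance_def amht_wf_def)

lemma prob_space_step_noise: "prob_space (step_noise c)"
  unfolding step_noise_def by (intro prob_space_pair_gaussian_matrix variances_pos)

lemma amht_sums_sensitivity:
  assumes nbr: "neighbours D D'" and l: "l \<in> {1..iterations c}"
  shows "norm (fst (amht_sums c D l h) - fst (amht_sums c D' l h)) \<le>
      real (batch_size c) * (clip_x c)\<^sup>2 * (clip_w c)\<^sup>2"
    and "norm (snd (amht_sums c D l h) - snd (amht_sums c D' l h)) \<le>
      real (batch_size c) * clip_x c * (clip_y c + clip_q c) * clip_w c"
proof -
  have m: "card (batch c l) = batch_size c" using wf l by (simp add: amht_wf_def)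
  have fin: "finite (dom D)" "finite (dom D')" using nbr by (auto simp: neighbours_def is_dataset_def)
  obtain i X where "i \<notin> dom D \<and> D' = D(i \<mapsto> X) \<or> i \<notin> dom D' \<and> D = D'(i \<mapsto> X)"
    using nbr by (auto simp: neighbours_def)
  then obtain w b where
    "amht_sums c D' l h = amht_sums c D l h + (user_A c l X w, user_V c l X w b) \<or>
     amht_sums c D l h = amht_sums c D' l h + (user_A c l X w, user_V c l X w b)"
    using amht_sums_add_user[OF fin(1)] amht_sums_add_user[OF fin(2)] by metis
  then have "norm (fst (amht_sums c D l h) - fst (amht_sums c D' l h)) = norm (user_A c l X w) \<and>
      norm (snd (amht_sums c D l h) - snd (amht_sums c D' l h)) = norm (user_V c l X w b)"
    by auto
  then show "norm (fst (amht_sums c D l h) - fst (amht_sums c D' l h)) \<le>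
      real (batch_size c) * (clip_x c)\<^sup>2 * (clip_w c)\<^sup>2"
    "norm (snd (amht_sums c D l h) - snd (amht_sums c D' l h)) \<le>
      real (batch_size c) * clip_x c * (clip_y c + clip_q c) * clip_w c"
    using norm_user_A_le[of c l X w] norm_user_V_le[of c l X w b] clips m by simp_all
qed

lemma measurable_shared_map:
  "(\<lambda>y :: ((real, 'r \<times> 'd) vec, 'r \<times> 'd) vec \<times> ((real, 'r) vec, 'd) vec.
      qr c (unstack_columns (matrix_inv (fst y) *v stack_columns (snd y)))) \<in> borel_measurable borel"
proof -
  have [measurable]: "qr c \<in> borel_measurable borel" using wf by (simp add: amht_wf_def)
  note fs = borel_measurable_fst_snd[of "\<lambda>x. x" borel, OF measurable_ident_sets[OF refl]]
  have "(\<lambda>y :: ((real, 'r \<times> 'd) vec, 'r \<times> 'd) vec \<times> ((real, 'r) vec, 'd) vec. matrix_inv (fst y) *v stack_columns (snd y)) \<in> borel_measurable borel"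
    by (rule borel_measurable_matrix_inv_mult_vec[OF fs(1)
        measurable_compose[OF fs(2) borel_measurable_stack_columns]])
  then show ?thesis by measurable
qed

text \<open>Once the normalization cancels, the data enters only through the shift of the noise, and
  the outer map is the same for all data sets. On singular matrices the cancellation can fail, so
  the identity is one of laws.\<close>

lemma distr_shared_update:
  assumes D: "is_dataset D"
  shows "distr (step_noise c) borel (shared_update c D l h) =
    distr (distr (step_noise c) borel ((+) (amht_sums c D l h))) borel
      (\<lambda>y. qr c (unstack_columns (matrix_inv (fst y) *v stack_columns (snd y))))"
proof -
  let ?G = "\<lambda>y. qr c (unstack_columns (matrix_inv (fst y) *v stack_columns (snd y)))"
  let ?S = "amht_sums c D l h"
  note G[measurable] = measurable_shared_map
  have u[measurable]: "shared_update c D l h \<in> borel_measurable borel"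
    by (rule measurable_shared_update[OF wf]) simp_all
  have u': "shared_update c D l h \<in> borel_measurable (step_noise c)"
    using u by (simp cong: measurable_cong_sets)
  have "(\<lambda>y. ?G (?S + y)) \<in> borel_measurable borel"
    by (rule measurable_compose[OF _ G]) simp
  then have GS: "(\<lambda>y. ?G (?S + y)) \<in> borel_measurable (step_noise c)"
    by (simp only: measurable_cong_sets[OF sets_step_noise refl])
  interpret G2: prob_space "gaussian_matrix (V_variance c) :: ((real, 'r) vec, 'd) vec measure"
    by (intro prob_space_gaussian_matrix variances_pos)
  have "AE N in gaussian_matrix (A_variance c). det (fst ?S + N) \<noteq> 0"
    by (intro AE_gaussian_matrix_nonsingular variances_pos)
  then have "AE y in step_noise c. det (fst ?S + fst y) \<noteq> 0"
    unfolding step_noise_def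
    by (subst (asm) G2.distr_pair_fst[symmetric]) (rule AE_distrD[OF measurable_fst])
  then have "AE y in step_noise c. shared_update c D l h y = ?G (?S + y)"
    by eventually_elim (rule shared_update_eq[OF wf D])
  then have "distr (step_noise c) borel (shared_update c D l h) =
      distr (step_noise c) borel (\<lambda>y. ?G (?S + y))"
    by (rule distr_cong_AE[OF refl refl _ u' GS])
  also have "\<dots> = distr (distr (step_noise c) borel ((+) ?S)) borel ?G"
    by (subst distr_distr) (simp_all add: comp_def)
  finally show ?thesis .
qed

text \<open>Both data sets are run on the same arbitrary history. The map common to both updates is
  post-processing, so only the two pairs of shifted Gaussians have to be compared.\<close>

lemma renyi_dominated_shared_update:
  assumes \<alpha>: "\<alpha> > 1" and nbr: "neighbours D D'" and l: "l \<in> {1..iterations c}"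
  shows "renyi_dominated \<alpha> (1 / (real (iterations c) * (noise_mult c)\<^sup>2))
    (distr (step_noise c) borel (shared_update c D l h))
    (distr (step_noise c) borel (shared_update c D' l h))"
proof -
  let ?S = "amht_sums c D l h" and ?T = "amht_sums c D' l h"
  have D: "is_dataset D" "is_dataset D'" using nbr by (auto simp: neighbours_def)
  have m: "real (batch_size c) > 0" using wf by (simp add: amht_wf_def)
  have "renyi_dominated \<alpha> ((norm (fst ?S - fst ?T))\<^sup>2 / (2 * A_variance c) +
        (norm (snd ?S - snd ?T))\<^sup>2 / (2 * V_variance c))
      (distr (step_noise c) borel ((+) ?S)) (distr (step_noise c) borel ((+) ?T))"
    using renyi_dominated_pair_gaussian_shifts[OF \<alpha> variances_pos, of "fst ?S" "fst ?T" "snd ?S" "snd ?T"]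
    by (simp add: step_noise_def)
  then have "renyi_dominated \<alpha> (1 / (real (iterations c) * (noise_mult c)\<^sup>2))
      (distr (step_noise c) borel ((+) ?S)) (distr (step_noise c) borel ((+) ?T))"
  proof (rule renyi_dominated_mono[OF _ _ \<alpha>])
    have "(norm (fst ?S - fst ?T))\<^sup>2 / (2 * A_variance c) \<le> 1 / (2 * real (iterations c) * (noise_mult c)\<^sup>2)"
      by (rule sensitivity_bound[OF amht_sums_sensitivity(1)[OF nbr l]])
        (use clips \<sigma> iters m in \<open>auto simp: A_variance_def power_mult_distrib power_mult[symmetric]\<close>)
    moreover have "(norm (snd ?S - snd ?T))\<^sup>2 / (2 * V_variance c) \<le> 1 / (2 * real (iterations c) * (noise_mult c)\<^sup>2)"
      by (rule sensitivity_bound[OF amht_sums_sensitivity(2)[OF nbr l]])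
        (use clips \<sigma> iters m in \<open>auto simp: V_variance_def power_mult_distrib\<close>)
    moreover have "1 / (2 * real (iterations c) * (noise_mult c)\<^sup>2) +
        1 / (2 * real (iterations c) * (noise_mult c)\<^sup>2) = 1 / (real (iterations c) * (noise_mult c)\<^sup>2)"
      by simp
    ultimately show "(norm (fst ?S - fst ?T))\<^sup>2 / (2 * A_variance c) +
        (norm (snd ?S - snd ?T))\<^sup>2 / (2 * V_variance c) \<le> 1 / (real (iterations c) * (noise_mult c)\<^sup>2)"
      using add_mono by fastforce
  qed
  then show ?thesis
    unfolding distr_shared_update[OF D(1)] distr_shared_update[OF D(2)]
    by (rule renyi_dominated_distr) (simp add: measurable_shared_map)
qed

section \<open>Adaptive composition over the iterations\<close>

lemma atLeastAtMost_Suc_union: "{1..Suc n} = {1..n} \<union> {Suc n}"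
  by auto

lemma measurable_published_upto:
  assumes "n \<le> m"
  shows "published_upto c D n \<in> measurable (\<Pi>\<^sub>M l\<in>{1..m}. step_noise c) (\<Pi>\<^sub>M l\<in>{1..n}. borel)"
  using assms
proof (induction n)
  case 0
  show ?case by (auto simp: published_upto_def measurable_def space_PiM sets_PiM_empty)
next
  case (Suc n)
  let ?M = "\<Pi>\<^sub>M l\<in>{1..m}. step_noise c"
  have IH: "published_upto c D n \<in> measurable ?M (\<Pi>\<^sub>M l\<in>{1..n}. borel)"
    using Suc by simp
  have comp: "(\<lambda>N. published_upto c D n N k) \<in> borel_measurable ?M" if "0 < k" "k < Suc n" for k
    using measurable_compose[OF IH measurable_component_singleton[of k]] that by simp
  have N: "(\<lambda>N. N (Suc n)) \<in> borel_measurable ?M"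
    using measurable_component_singleton[of "Suc n" "{1..m}" "\<lambda>_. step_noise c"] Suc.prems
    by (simp cong: measurable_cong_sets)
  have "(\<lambda>N. (published_upto c D n N)(Suc n := shared_update c D (Suc n) (published_upto c D n N) (N (Suc n))))
      \<in> measurable ?M (\<Pi>\<^sub>M l\<in>{1..Suc n}. borel)"
    by (rule measurable_fun_upd[OF atLeastAtMost_Suc_union IH]) (rule measurable_shared_update[OF wf comp N])
  then show ?case
    by (simp only: published_upto_Suc[abs_def])
qed

text \<open>The law of a longer prefix is the law of the shorter one followed by the kernel
  \<open>?K\<close> of the next iteration, so each induction step adds the cost of one
  iteration.\<close>

lemma renyi_dominated_published_upto:
  assumes \<alpha>: "\<alpha> > 1" and nbr: "neighbours D D'" and n: "n \<le> iterations c"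
  shows "renyi_dominated \<alpha> (real n * (1 / (real (iterations c) * (noise_mult c)\<^sup>2)))
    (distr (\<Pi>\<^sub>M l\<in>{1..n}. step_noise c) (\<Pi>\<^sub>M l\<in>{1..n}. borel) (published_upto c D n))
    (distr (\<Pi>\<^sub>M l\<in>{1..n}. step_noise c) (\<Pi>\<^sub>M l\<in>{1..n}. borel) (published_upto c D' n))"
  using n
proof (induction n)
  case 0
  have "prob_space (distr (\<Pi>\<^sub>M l\<in>{1..0}. step_noise c) (\<Pi>\<^sub>M l\<in>{1..0}. borel) (published_upto c D 0))"
    by (intro prob_space.prob_space_distr prob_space_PiM prob_space_step_noise measurable_published_upto) simp
  moreover have "published_upto c D 0 = published_upto c D' 0"
    by (simp add: published_upto_def fun_eq_iff)
  ultimately show ?case using renyi_dominated_refl[OF _ \<alpha>] by simp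
next
  case (Suc n)
  let ?\<nu> = "step_noise c"
  let ?N = "\<lambda>n. \<Pi>\<^sub>M l\<in>{1..n}. step_noise c" and ?B = "\<lambda>n. \<Pi>\<^sub>M l\<in>{1..n}. (borel :: ((real, 'r) vec, 'd) vec measure)"
  let ?P = "\<lambda>D n. distr (?N n) (?B n) (published_upto c D n)"
  let ?\<rho> = "1 / (real (iterations c) * (noise_mult c)\<^sup>2)"
  interpret nu: product_sigma_finite "\<lambda>_::nat. step_noise c"
    by (intro product_sigma_finite.intro prob_space_imp_sigma_finite prob_space_step_noise)
  have nu_sigma: "sigma_finite_measure ?\<nu>"
    by (intro prob_space_imp_sigma_finite prob_space_step_noise)
  have probN: "prob_space (?N k)" for k
    by (intro prob_space_PiM prob_space_step_noise)
  have pm: "published_upto c E k \<in> measurable (?N k) (?B k)" for E k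
    by (rule measurable_published_upto) simp
  have probP: "prob_space (?P E k)" for E k
    by (intro prob_space.prob_space_distr probN pm)
  \<comment> \<open>\<open>J\<close> averages over the fresh noise with the history held fixed. It
    is the kernel integral written on the noise space, where joint measurability and Fubini are
    available.\<close>
  define J where "J E g h = (\<integral>y. g (h(Suc n := shared_update c E (Suc n) h y)) \<partial>?\<nu>)"
    for E and g :: "_ \<Rightarrow> real" and h
  have upd: "(\<lambda>z. (fst z)(Suc n := shared_update c E (Suc n) (fst z) (snd z)))
      \<in> measurable (?B n \<Otimes>\<^sub>M ?\<nu>) (?B (Suc n))" for E
  proof -
    have "(\<lambda>z. shared_update c E (Suc n) (fst z) (snd z)) \<in> borel_measurable (?B n \<Otimes>\<^sub>M ?\<nu>)"
    proof (rule measurable_shared_update[OF wf])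
      fix k assume "0 < k" "k < Suc n"
      then have "k \<in> {1..n}" by simp
      then show "(\<lambda>z. fst z k) \<in> borel_measurable (?B n \<Otimes>\<^sub>M ?\<nu>)"
        by (rule measurable_compose[OF measurable_fst measurable_component_singleton])
    next
      show "snd \<in> borel_measurable (?B n \<Otimes>\<^sub>M ?\<nu>)"
        using measurable_snd[of "?B n" ?\<nu>] by (simp cong: measurable_cong_sets)
    qed
    then have "(\<lambda>z. (fst z)(Suc n := shared_update c E (Suc n) (fst z) (snd z)))
        \<in> measurable (?B n \<Otimes>\<^sub>M ?\<nu>) (\<Pi>\<^sub>M l\<in>{1..Suc n}. borel)"
      by (rule measurable_fun_upd[OF atLeastAtMost_Suc_union measurable_fst])
    then show ?thesis .
  qed
  have Jm: "J E g \<in> borel_measurable (?B n)" if "g \<in> borel_measurable (?B (Suc n))" for E g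
    using sigma_finite_measure.borel_measurable_lebesgue_integral[OF nu_sigma,
        of "\<lambda>h y. g (h(Suc n := shared_update c E (Suc n) h y))" "?B n"]
      measurable_compose[OF upd that]
    unfolding J_def by (simp add: case_prod_beta')
  have kernel_m: "(\<lambda>u. g (h(Suc n := u))) \<in> borel_measurable borel"
    if g: "g \<in> borel_measurable (?B (Suc n))" and h: "h \<in> space (?B n)" for g :: "_ \<Rightarrow> real" and h
  proof -
    have "(\<lambda>u. h(Suc n := u)) \<in> measurable borel (\<Pi>\<^sub>M l\<in>{1..Suc n}. borel)"
      by (rule measurable_fun_upd[OF atLeastAtMost_Suc_union measurable_const[OF h]]) simp
    from measurable_compose[OF this g] show ?thesis .
  qed
  have J_eq: "J E g h = (\<integral>u. g (h(Suc n := u)) \<partial>distr ?\<nu> borel (shared_update c E (Suc n) h))"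
    if g: "g \<in> borel_measurable (?B (Suc n))" and h: "h \<in> space (?B n)" for E g h
    unfolding J_def
  proof (rule integral_distr[symmetric])
    show "shared_update c E (Suc n) h \<in> borel_measurable ?\<nu>"
      using measurable_shared_update[OF wf, of "Suc n" "\<lambda>_. h" ?\<nu> "\<lambda>y. y" E] by simp
  qed (rule kernel_m[OF g h])
  \<comment> \<open>Fubini isolates the last noise variable, on which the earlier published matrices
    do not depend.\<close>
  have int_P: "(\<integral>h. g h \<partial>?P E (Suc n)) = (\<integral>h. J E g h \<partial>?P E n)"
    if g: "g \<in> borel_measurable (?B (Suc n))" and bd: "\<And>h. 0 \<le> g h" "\<And>h. g h \<le> C" for g C E
  proof -
    have ins: "{1..Suc n} = insert (Suc n) {1..n}" by auto
    have gm: "(\<lambda>N. g (published_upto c E (Suc n) N)) \<in> borel_measurable (?N (Suc n))"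
      using measurable_compose[OF pm g] .
    have "(\<integral>h. g h \<partial>?P E (Suc n)) = (\<integral>N. g (published_upto c E (Suc n) N) \<partial>?N (Suc n))"
      by (rule integral_distr[OF pm g])
    also have "\<dots> = (\<integral>N. \<integral>y. g (published_upto c E (Suc n) (N(Suc n := y))) \<partial>?\<nu> \<partial>?N n)"
      unfolding ins
      by (rule nu.product_integral_insert)
        (use integrable_bounded[OF probN gm bd] in \<open>simp_all add: ins del: One_nat_def\<close>)
    also have "\<dots> = (\<integral>N. J E g (published_upto c E n N) \<partial>?N n)"
    proof -
      have "published_upto c E (Suc n) (N(Suc n := y)) = (published_upto c E n N)
          (Suc n := shared_update c E (Suc n) (published_upto c E n N) y)" for N y
      proof -
        have "published_upto c E n (N(Suc n := y)) = published_upto c E n N"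
          by (rule published_upto_cong) simp
        then show ?thesis by (simp add: published_upto_Suc)
      qed
      then show ?thesis by (simp add: J_def)
    qed
    also have "\<dots> = (\<integral>h. J E g h \<partial>?P E n)"
      by (rule integral_distr[OF pm Jm[OF g], symmetric])
    finally show ?thesis .
  qed
  have IH: "renyi_dominated \<alpha> (real n * ?\<rho>) (?P D n) (?P D' n)"
    using Suc by simp
  show ?case
  proof (rule renyi_dominatedI)
    fix f :: "(nat \<Rightarrow> ((real, 'r) vec, 'd) vec) \<Rightarrow> real" and C
    assume "f \<in> borel_measurable (?P D' (Suc n))" and bd: "\<And>x. 0 \<le> f x" "\<And>x. f x \<le> C"
    then have f: "f \<in> borel_measurable (?B (Suc n))" by simp
    let ?b = "\<alpha> / (\<alpha> - 1)"
    let ?K = "\<lambda>E h. distr ?\<nu> borel (shared_update c E (Suc n) h)"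
    have fp: "(\<lambda>h. f h powr ?b) \<in> borel_measurable (?B (Suc n))" using f by measurable
    have bdp: "0 \<le> f h powr ?b" "f h powr ?b \<le> C powr ?b" for h
      using powr_bounded[of f C ?b h] bd \<alpha> by auto
    have cong: "(\<integral>h. J E g h \<partial>?P E' n) = (\<integral>h. \<integral>u. g (h(Suc n := u)) \<partial>?K E h \<partial>?P E' n)"
      if "g \<in> borel_measurable (?B (Suc n))" for g :: "_ \<Rightarrow> real" and E E'
      by (rule Bochner_Integration.integral_cong[OF refl]) (simp add: J_eq[OF that])
    \<comment> \<open>Composition integrates the kernel of one data set over histories of the other,
      hence the separate \<open>E\<close> and \<open>E'\<close>.\<close>
    have meas: "(\<lambda>h. \<integral>u. g (h(Suc n := u)) \<partial>?K E h) \<in> borel_measurable (?P E' n)"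
      if "g \<in> borel_measurable (?B (Suc n))" for g :: "_ \<Rightarrow> real" and E E'
    proof -
      have "(\<lambda>h. \<integral>u. g (h(Suc n := u)) \<partial>?K E h) \<in> borel_measurable (?B n)"
        using Jm[OF that, of E] by (rule measurable_cong[THEN iffD1, rotated]) (rule J_eq[OF that])
      then show ?thesis by (simp only: measurable_distr_eq1)
    qed
    have "(\<integral>h. f h \<partial>?P D (Suc n)) = (\<integral>h. \<integral>u. f (h(Suc n := u)) \<partial>?K D h \<partial>?P D n)"
      by (simp only: int_P[OF f bd] cong[OF f])
    also have "\<dots> \<le> exp ((\<alpha> - 1) * (real n * ?\<rho> + ?\<rho>)) *
        (\<integral>h. \<integral>u. f (h(Suc n := u)) powr ?b \<partial>?K D' h \<partial>?P D' n) powr ((\<alpha> - 1) / \<alpha>)"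
    proof (rule renyi_dominated_compose[OF \<alpha> IH _ _ bd meas[OF f] meas[OF fp]])
      fix h
      show "renyi_dominated \<alpha> ?\<rho> (?K D h) (?K D' h)"
        using Suc.prems by (intro renyi_dominated_shared_update \<alpha> nbr) simp
      assume "h \<in> space (?P D' n)"
      then show "(\<lambda>u. f (h(Suc n := u))) \<in> borel_measurable (?K D' h)"
        using kernel_m[OF f] by simp
    qed
    also have "(\<integral>h. \<integral>u. f (h(Suc n := u)) powr ?b \<partial>?K D' h \<partial>?P D' n) =
        (\<integral>h. f h powr ?b \<partial>?P D' (Suc n))"
      by (simp only: int_P[OF fp bdp] cong[OF fp])
    also have "real n * ?\<rho> + ?\<rho> = real (Suc n) * ?\<rho>"
      by (simp add: algebra_simps add_divide_distrib)
    finally show "(\<integral>h. f h \<partial>?P D (Suc n)) \<le> exp ((\<alpha> - 1) * (real (Suc n) * ?\<rho>)) *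
        (\<integral>h. f h powr ?b \<partial>?P D' (Suc n)) powr ((\<alpha> - 1) / \<alpha>)" .
  qed (simp_all only: probP sets_distr)
qed

end

section \<open>The billboard law and the final constants\<close>

lemma amht_billboard_eq:
  "amht_billboard c D = distr (\<Pi>\<^sub>M l\<in>{1..iterations c}. step_noise c) (\<Pi>\<^sub>M l\<in>{1..iterations c}. borel)
     (published_upto c D (iterations c))"
proof -
  have "published c D = published_upto c D (iterations c)"
    by (simp add: published_def published_upto_def fun_eq_iff)
  then show ?thesis by (simp only: amht_billboard_def noise_law_eq)
qed

lemma renyi_dominated_amht_billboard:
  fixes c :: "('i, 's::finite, 'd::finite, 'r::{finite,linorder}) amht_input"
  assumes wf: "amht_wf c"
    and clips: "clip_x c > 0" "clip_y c > 0" "clip_q c > 0" "clip_w c > 0"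
    and \<sigma>: "noise_mult c > 0" and \<alpha>: "\<alpha> > 1" and nbr: "neighbours D D'"
  shows "renyi_dominated \<alpha> (1 / (noise_mult c)\<^sup>2) (amht_billboard c D) (amht_billboard c D')"
proof (cases "iterations c = 0")
  case True
  have "prob_space (amht_billboard c D)"
    unfolding amht_billboard_eq True
    by (intro prob_space.prob_space_distr prob_space_PiM)
      (auto simp: published_upto_def measurable_def space_PiM sets_PiM_empty)
  moreover have "amht_billboard c D' = amht_billboard c D"
  proof -
    have "published_upto c D' 0 = published_upto c D 0"
      by (simp add: published_upto_def fun_eq_iff)
    then show ?thesis unfolding amht_billboard_eq True by (simp only:)
  qed
  ultimately show ?thesis
    by (simp add: renyi_dominated_mono[OF renyi_dominated_refl[OF _ \<alpha>] _ \<alpha>])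
next
  case False
  then have "iterations c > 0" by simp
  from renyi_dominated_published_upto[OF wf clips \<sigma> this \<alpha> nbr order_refl] False
  show ?thesis by (simp only: amht_billboard_eq) simp
qed

theorem theorem2:
  fixes c :: "('i, 's::finite, 'd::finite, 'r::{finite,linorder}) amht_input"
  assumes "amht_wf c"
    and "clip_x c > 0" and "clip_y c > 0" and "clip_q c > 0" and "clip_w c > 0"
    and "noise_mult c > 0"
  shows "zCDP neighbours (amht_billboard c) (1 / (noise_mult c)\<^sup>2)
    \<and> (\<forall>\<epsilon> \<delta>. \<epsilon> > 0 \<and> 0 < \<delta> \<and> \<delta> < 1 \<and>
         noise_mult c \<ge> 2 / \<epsilon> * sqrt (ln (1 / \<delta>) + \<epsilon>) \<longrightarrow>
         differentially_private neighbours (amht_billboard c) \<epsilon> \<delta>)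
    \<and> (\<forall>\<epsilon> \<delta>. \<epsilon> > 0 \<and> 0 < \<delta> \<and> \<delta> < 1 \<and> \<epsilon> \<le> ln (1 / \<delta>) \<and>
         noise_mult c \<ge> 1 / \<epsilon> * sqrt (8 * ln (1 / \<delta>)) \<longrightarrow>
         differentially_private neighbours (amht_billboard c) \<epsilon> \<delta>)"
proof -
  note dom = renyi_dominated_amht_billboard[OF assms]
  \<comment> \<open>Both noise conditions reduce to this one; squaring it gives the hypothesis of
    the conversion with \<rho> equal to \<open>1 / (noise_mult c)\<^sup>2\<close>.\<close>
  have dp: "differentially_private neighbours (amht_billboard c) \<epsilon> \<delta>"
    if \<epsilon>: "\<epsilon> > 0" and \<delta>: "0 < \<delta>" "\<delta> < 1"
      and le: "sqrt (4 * (ln (1 / \<delta>) + \<epsilon>)) \<le> \<epsilon> * noise_mult c" for \<epsilon> \<delta>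
  proof (rule differentially_private_of_renyi_dominated[OF dom])
    have "4 * (ln (1 / \<delta>) + \<epsilon>) \<le> (\<epsilon> * noise_mult c)\<^sup>2"
      using le by (rule sqrt_le_D)
    then show "4 * (1 / (noise_mult c)\<^sup>2) * (ln (1 / \<delta>) + \<epsilon>) \<le> \<epsilon>\<^sup>2"
      using assms(6) by (simp add: field_simps)
  qed (use \<epsilon> \<delta> assms(6) in auto)
  have "zCDP neighbours (amht_billboard c) (1 / (noise_mult c)\<^sup>2)"
    unfolding zCDP_def by (intro allI impI renyi_divergence_le dom) simp_all
  moreover have "differentially_private neighbours (amht_billboard c) \<epsilon> \<delta>"
    if "\<epsilon> > 0" "0 < \<delta>" "\<delta> < 1" "noise_mult c \<ge> 2 / \<epsilon> * sqrt (ln (1 / \<delta>) + \<epsilon>)" for \<epsilon> \<delta>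
  proof (rule dp)
    show "sqrt (4 * (ln (1 / \<delta>) + \<epsilon>)) \<le> \<epsilon> * noise_mult c"
      using that unfolding real_sqrt_mult by (simp add: pos_divide_le_eq mult.commute)
  qed fact+
  moreover have "differentially_private neighbours (amht_billboard c) \<epsilon> \<delta>"
    if "\<epsilon> > 0" "0 < \<delta>" "\<delta> < 1" "\<epsilon> \<le> ln (1 / \<delta>)"
      "noise_mult c \<ge> 1 / \<epsilon> * sqrt (8 * ln (1 / \<delta>))" for \<epsilon> \<delta>
  proof (rule dp)
    \<comment> \<open>Here \<epsilon> is absorbed into a second copy of the logarithm, which turns
      the factor 4 into 8.\<close>
    have "sqrt (4 * (ln (1 / \<delta>) + \<epsilon>)) \<le> sqrt (8 * ln (1 / \<delta>))"
      using that(4) by (intro real_sqrt_le_mono) simp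
    also have "\<dots> \<le> \<epsilon> * noise_mult c"
      using that(1,5) by (simp add: pos_divide_le_eq mult.commute)
    finally show "sqrt (4 * (ln (1 / \<delta>) + \<epsilon>)) \<le> \<epsilon> * noise_mult c" .
  qed fact+
  ultimately show ?thesis by blast
qed


end
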